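(* Let $(\Omega,\mu)$ be a measure space, $1<p<\infty$, and let $T\colon L^p(\Omega)\to L^p(\Omega)$ be contractively regular. Then for any $x\in L^p(\Omega)$, $$[M_n(T)x](\lambda)\longrightarrow[P_T(x)](\lambda)\quad (n\to\infty)\qquad\text{for a.e. }\lambda\in\Omega .$$
   Context: $L^p$-spaces are complex. A bounded linear operator $T$ on $L^p(\Omega)$ is regular if there is $C\ge 0$ with $\Vert \sup_k |T(x_k)|\Vert_p\le C\Vert \sup_k|x_k|\Vert_p$ for all finite sequences $(x_k)_{k\ge1}$ in $L^p(\Omega)$; the least such $C$ is $\Vert T\Vert_r$, and $T$ is contractively regular if $\Vert T\Vert_r\le 1$. The ergodic averages are $M_n(T)=\frac{1}{n+1}\sum_{k=0}^{n}T^k$. For a contraction $T$ on $L^p(\Omega)$ the Mean Ergodic Theorem gives $L^p(\Omega)=N(I-T)\oplus\overline{R(I-T)}$ ($N$ = kernel, $R$ = range); $P_T$ denotes the corresponding projection onto $N(I-T)$. *)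

theory Defs
  imports "HOL-Analysis.Analysis"
begin

text \<open>
  Elements of the complex space $L^p$ are represented by functions, two functions being
  identified when they agree almost everywhere. An operator on $L^p$ is represented by a map on
  functions that respects this identification; its values outside \<open>Lp M p\<close> are irrelevant.
  Every operator on classes arises in this way, by choosing representatives.
\<close>

definition Lp :: "'a measure \<Rightarrow> real \<Rightarrow> ('a \<Rightarrow> complex) set" where
  "Lp M p = {f. f \<in> borel_measurable M \<and> integrable M (\<lambda>\<omega>. norm (f \<omega>) powr p)}"

text \<open>
  The codomain is left general so that the norm also applies to the real functions
  $\sup_k |x_k|$. The Bochner integral is 0 for non-integrable functions, so the value is
  meaningful only if \<open>norm (f \<omega>) powr p\<close> is integrable; this is the case wherever it is used.
\<close>

definition Lp_norm :: "'a measure \<Rightarrow> real \<Rightarrow> ('a \<Rightarrow> 'b::real_normed_vector) \<Rightarrow> real" where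
  "Lp_norm M p f = (\<integral>\<omega>. norm (f \<omega>) powr p \<partial>M) powr (1 / p)"

definition Lp_bounded_linear ::
    "'a measure \<Rightarrow> real \<Rightarrow> (('a \<Rightarrow> complex) \<Rightarrow> ('a \<Rightarrow> complex)) \<Rightarrow> bool" where
  "Lp_bounded_linear M p T \<longleftrightarrow>
     (\<forall>f\<in>Lp M p. T f \<in> Lp M p) \<and>
     (\<forall>f\<in>Lp M p. \<forall>g\<in>Lp M p. (AE \<omega> in M. f \<omega> = g \<omega>) \<longrightarrow> (AE \<omega> in M. T f \<omega> = T g \<omega>)) \<and>
     (\<forall>f\<in>Lp M p. \<forall>g\<in>Lp M p. AE \<omega> in M. T (\<lambda>\<omega>. f \<omega> + g \<omega>) \<omega> = T f \<omega> + T g \<omega>) \<and>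
     (\<forall>c. \<forall>f\<in>Lp M p. AE \<omega> in M. T (\<lambda>\<omega>. c * f \<omega>) \<omega> = c * T f \<omega>) \<and>
     (\<exists>C. \<forall>f\<in>Lp M p. Lp_norm M p (T f) \<le> C * Lp_norm M p f)"

definition regular_bound ::
    "'a measure \<Rightarrow> real \<Rightarrow> (('a \<Rightarrow> complex) \<Rightarrow> ('a \<Rightarrow> complex)) \<Rightarrow> real \<Rightarrow> bool" where
  "regular_bound M p T C \<longleftrightarrow> C \<ge> 0 \<and>
     (\<forall>(n::nat) x. (\<forall>k\<le>n. x k \<in> Lp M p) \<longrightarrow>
        Lp_norm M p (\<lambda>\<omega>. MAX k\<in>{..n}. norm (T (x k) \<omega>))
          \<le> C * Lp_norm M p (\<lambda>\<omega>. MAX k\<in>{..n}. norm (x k \<omega>)))"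

definition regular ::
    "'a measure \<Rightarrow> real \<Rightarrow> (('a \<Rightarrow> complex) \<Rightarrow> ('a \<Rightarrow> complex)) \<Rightarrow> bool" where
  "regular M p T \<longleftrightarrow> Lp_bounded_linear M p T \<and> (\<exists>C. regular_bound M p T C)"

text \<open>For regular \<open>T\<close> the set of bounds is a closed, nonempty subset of $[0,\infty)$, so the
  infimum is the least bound.\<close>

definition regular_norm ::
    "'a measure \<Rightarrow> real \<Rightarrow> (('a \<Rightarrow> complex) \<Rightarrow> ('a \<Rightarrow> complex)) \<Rightarrow> real" where
  "regular_norm M p T = Inf {C. regular_bound M p T C}"

definition contractively_regular ::
    "'a measure \<Rightarrow> real \<Rightarrow> (('a \<Rightarrow> complex) \<Rightarrow> ('a \<Rightarrow> complex)) \<Rightarrow> bool" where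
  "contractively_regular M p T \<longleftrightarrow> regular M p T \<and> regular_norm M p T \<le> 1"

definition ergodic_average ::
    "(('a \<Rightarrow> complex) \<Rightarrow> ('a \<Rightarrow> complex)) \<Rightarrow> nat \<Rightarrow> ('a \<Rightarrow> complex) \<Rightarrow> ('a \<Rightarrow> complex)" where
  "ergodic_average T n x = (\<lambda>\<omega>. (1 / of_nat (n + 1)) * (\<Sum>k=0..n. (T ^^ k) x \<omega>))"

definition ker_I_minus ::
    "'a measure \<Rightarrow> real \<Rightarrow> (('a \<Rightarrow> complex) \<Rightarrow> ('a \<Rightarrow> complex)) \<Rightarrow> ('a \<Rightarrow> complex) set" where
  "ker_I_minus M p T = {y \<in> Lp M p. AE \<omega> in M. y \<omega> - T y \<omega> = 0}"

definition closure_range_I_minus ::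
    "'a measure \<Rightarrow> real \<Rightarrow> (('a \<Rightarrow> complex) \<Rightarrow> ('a \<Rightarrow> complex)) \<Rightarrow> ('a \<Rightarrow> complex) set" where
  "closure_range_I_minus M p T =
     {z \<in> Lp M p. \<forall>e>0. \<exists>u\<in>Lp M p. Lp_norm M p (\<lambda>\<omega>. z \<omega> - (u \<omega> - T u \<omega>)) < e}"

text \<open>
  The component of \<open>x\<close> in $N(I-T)$ for the decomposition
  $L^p = N(I-T) \oplus \overline{R(I-T)}$. It is determined only up to null sets, hence the
  choice of a representative.
\<close>

definition mean_ergodic_projection ::
    "'a measure \<Rightarrow> real \<Rightarrow> (('a \<Rightarrow> complex) \<Rightarrow> ('a \<Rightarrow> complex)) \<Rightarrow> ('a \<Rightarrow> complex) \<Rightarrow> ('a \<Rightarrow> complex)"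
  where
  "mean_ergodic_projection M p T x =
     (SOME y. y \<in> ker_I_minus M p T \<and> (\<lambda>\<omega>. x \<omega> - y \<omega>) \<in> closure_range_I_minus M p T)"

end

(* Akcoglu's theorem without dilations. The maximal inequality of a positive contraction T on a
   finite-dimensional L^p is dual to a bound by q = p / (p - 1) on S = sum_k R^k G_k, where R is the
   adjoint of T and G_0 >= G_1 >= ... >= 0: the norm of S is at most q times that of sum_k G_k.
   The tails S_k = sum_i R^i G_{k+i} satisfy S_k = G_k + R S_{k+1} and, G being decreasing, S_k <= S.
   Since |a + b|^q - |b|^q <= q a |a + b|^(q-1) and R is a contraction, the q-th powers of the norms
   of S_k and S_{k+1} differ by at most q int G_k S^(q-1), and summing over k gives
   ||S||^q <= q int (sum_k G_k) S^(q-1).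
   A contractively regular T is compared on finitely many iterates of x with a matrix, obtained by
   averaging over a finite partition; by regularity the matrix of absolute values is a contraction.
   The mean ergodic theorem follows from uniform convexity, and the maximal inequality reduces the
   pointwise statement to fixed vectors and coboundaries u - Tu. *)

theory Submission
  imports Defs
begin

section \<open>Elementary inequalities\<close>

text \<open>An average of length \<open>n + 1\<close>, with the time n chosen separately at every
  point, has coefficients \<open>1 / (n + 1)\<close> up to that time and 0 afterwards. They decrease
  in the iteration index, and transposing the choice turns them into the decreasing family G. The
  obstacle on the way to a contractively regular T is that T is not positive and that its modulus on
  the function space is a lattice supremum, which would have to be constructed. For a matrix the
  modulus is taken entry by entry, and regularity, a statement about finitely many functions at
  once, is what bounds it. Treating finitely many iterates at a time also makes every sum finite, so
  that a term of Young's inequality can be absorbed into the left side, and it confines the argument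
  to sets of finite measure up to a small error in norm, so that arbitrary measure spaces are
  covered. What the convergence proof takes from the constant \<open>p / (p - 1)\<close> is its
  independence of the number of iterates and of the partition.\<close>

lemma powr_tangent_le:
  fixes a m p :: real
  assumes "1 < p" "0 \<le> a" "0 \<le> m"
  shows "m powr p + p * m powr (p - 1) * (a - m) \<le> a powr p"
proof -
  have pq: "p / (p - 1) > 1" "1 / p + 1 / (p / (p - 1)) = 1"
    using assms(1) by (simp_all add: field_simps)
  \<comment> \<open>The tangent inequality is Young's inequality rearranged; obtained this way it
    includes \<open>m = 0\<close> without a derivative there.\<close>
  have "a * m powr (p - 1) \<le> a powr p / p + (m powr (p - 1)) powr (p / (p - 1)) / (p / (p - 1))"
    using assms pq by (intro Youngs_inequality) auto
  also have "(m powr (p - 1)) powr (p / (p - 1)) = m powr p"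
    using assms by (simp add: powr_powr)
  finally have "p * (a * m powr (p - 1)) \<le> a powr p + (p - 1) * m powr p"
    using assms(1) by (simp add: field_simps)
  moreover have "m powr (p - 1) * m = m powr p"
    using assms by (cases "m = 0") (simp_all add: powr_mult_base' powr_diff)
  ultimately show ?thesis
    by (simp add: algebra_simps)
qed

text \<open>Convexity of the power at \<open>a + b = (1 - l) * (a / (1 - l)) + l * (b / l)\<close>:
  the tangent at \<open>a + b\<close> is evaluated at both points and the linear terms cancel.
  Leaving \<open>l\<close> free gives a bound linear in the powers of \<open>a\<close> and
  \<open>b\<close>, which can be integrated before \<open>l\<close> is optimized.\<close>

lemma powr_add_le_weighted:
  fixes a b l p :: real
  assumes "1 < p" "0 \<le> a" "0 \<le> b" "0 < l" "l < 1"
  shows "(a + b) powr p \<le> (1 - l) powr (1 - p) * a powr p + l powr (1 - p) * b powr p"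
proof -
  let ?m = "a + b"
  let ?D = "p * ?m powr (p - 1)"
  have scale: "c * (x / c) powr p = c powr (1 - p) * x powr p" if "0 < c" "0 \<le> x" for c x :: real
    using that by (simp add: powr_divide powr_diff)
  have "?m powr p + ?D * (a / (1 - l) - ?m) \<le> (a / (1 - l)) powr p"
    using assms by (intro powr_tangent_le) auto
  then have 1: "(1 - l) * (?m powr p + ?D * (a / (1 - l) - ?m)) \<le> (1 - l) powr (1 - p) * a powr p"
    using mult_left_mono[of "?m powr p + ?D * (a / (1 - l) - ?m)" "(a / (1 - l)) powr p" "1 - l"]
      assms scale[of "1 - l" a] by simp
  have "?m powr p + ?D * (b / l - ?m) \<le> (b / l) powr p"
    using assms by (intro powr_tangent_le) auto
  then have 2: "l * (?m powr p + ?D * (b / l - ?m)) \<le> l powr (1 - p) * b powr p"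
    using mult_left_mono[of "?m powr p + ?D * (b / l - ?m)" "(b / l) powr p" l]
      assms scale[of l b] by simp
  have "(1 - l) * (E + D * (a / (1 - l) - ?m)) + l * (E + D * (b / l - ?m)) = E" for E D :: real
    using assms by (simp add: field_simps)
  from this[of "?m powr p" ?D]
  have "(1 - l) * (?m powr p + ?D * (a / (1 - l) - ?m)) + l * (?m powr p + ?D * (b / l - ?m))
      = ?m powr p" .
  with 1 2 show ?thesis by linarith
qed

section \<open>The maximal inequality for nonnegative matrices\<close>

text \<open>The coefficient type is general because a complex matrix and the real matrix of its
  absolute values are compared.\<close>

definition mat_op :: "'i set \<Rightarrow> ('i \<Rightarrow> 'i \<Rightarrow> 'b::comm_semiring_0) \<Rightarrow> ('i \<Rightarrow> 'b) \<Rightarrow> 'i \<Rightarrow> 'b" where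
  "mat_op I t f = (\<lambda>i. \<Sum>j\<in>I. t i j * f j)"

lemma mat_op_nonneg:
  fixes t :: "'i \<Rightarrow> 'i \<Rightarrow> real"
  assumes "\<And>i j. 0 \<le> t i j" "\<And>j. 0 \<le> f j"
  shows "0 \<le> mat_op I t f i"
  using assms by (simp add: mat_op_def sum_nonneg)

lemma mat_op_mono:
  fixes t :: "'i \<Rightarrow> 'i \<Rightarrow> real"
  assumes "\<And>i j. 0 \<le> t i j" "\<And>j. f j \<le> g j"
  shows "mat_op I t f i \<le> mat_op I t g i"
  using assms by (simp add: mat_op_def sum_mono mult_left_mono)

lemma mat_op_funpow_nonneg:
  fixes t :: "'i \<Rightarrow> 'i \<Rightarrow> real"
  assumes "\<And>i j. 0 \<le> t i j" "\<And>j. 0 \<le> f j"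
  shows "0 \<le> (mat_op I t ^^ k) f i"
  using assms by (induction k arbitrary: i) (simp_all add: mat_op_nonneg)

lemma mat_op_adjoint:
  "(\<Sum>j\<in>I. mat_op I (\<lambda>i j. t j i) g j * f j) = (\<Sum>i\<in>I. g i * mat_op I t f i)"
  unfolding mat_op_def sum_distrib_left sum_distrib_right
  by (subst sum.swap) (simp add: mult_ac)

lemma norm_mat_op_funpow_le:
  fixes t :: "'i \<Rightarrow> 'i \<Rightarrow> complex"
  shows "norm ((mat_op I t ^^ k) a i) \<le> (mat_op I (\<lambda>i j. norm (t i j)) ^^ k) (\<lambda>i. norm (a i)) i"
proof (induction k arbitrary: i)
  case (Suc k)
  have "(mat_op I t ^^ Suc k) a i = (\<Sum>j\<in>I. t i j * (mat_op I t ^^ k) a j)"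
    unfolding funpow.simps comp_def by (subst mat_op_def) simp
  then have "norm ((mat_op I t ^^ Suc k) a i)
      \<le> (\<Sum>j\<in>I. norm (t i j) * norm ((mat_op I t ^^ k) a j))"
    by (simp add: sum_norm_le norm_mult)
  also have "\<dots> \<le> (\<Sum>j\<in>I. norm (t i j) *
      (mat_op I (\<lambda>i j. norm (t i j)) ^^ k) (\<lambda>i. norm (a i)) j)"
    by (intro sum_mono mult_left_mono Suc) simp
  also have "\<dots> = (mat_op I (\<lambda>i j. norm (t i j)) ^^ Suc k) (\<lambda>i. norm (a i)) i"
    unfolding funpow.simps comp_def by (simp only: mat_op_def[of I "\<lambda>i j. norm (t i j)" "(_ ^^ _) _"])
  finally show ?case .
qed simp

(* Horner's scheme for the sum of R^i (G (k + i)) over i < m. *)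
fun horner_sum :: "(('i \<Rightarrow> real) \<Rightarrow> 'i \<Rightarrow> real) \<Rightarrow> (nat \<Rightarrow> 'i \<Rightarrow> real) \<Rightarrow> nat \<Rightarrow> nat \<Rightarrow> 'i \<Rightarrow> real" where
  "horner_sum R G 0 k = (\<lambda>_. 0)"
| "horner_sum R G (Suc m) k = (\<lambda>j. G k j + R (horner_sum R G m (Suc k)) j)"

text \<open>Contractivity is stated with sums of powers instead of norms, the form that fits the
  additive Young inequality.\<close>

locale positive_matrix_contraction =
  fixes I :: "'i set" and t :: "'i \<Rightarrow> 'i \<Rightarrow> real" and p q :: real
  assumes p: "1 < p" and q: "q = p / (p - 1)"
    and t_nonneg: "\<And>i j. 0 \<le> t i j"
    and contraction: "\<And>f. (\<And>i. 0 \<le> f i) \<Longrightarrow>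
          (\<Sum>i\<in>I. mat_op I t f i powr p) \<le> (\<Sum>i\<in>I. f i powr p)"
begin

abbreviation "R \<equiv> mat_op I (\<lambda>i j. t j i)"

lemma q_gt_1: "1 < q" and conj_exp: "1 / p + 1 / q = 1"
  and q_minus_1: "(q - 1) * p = q" and p_minus_1: "(p - 1) * q = p"
  using p by (simp_all add: q field_simps)

text \<open>Takes the place of Hoelder's inequality: in every application one of the two sums on the
  right is controlled by the left side and is absorbed.\<close>

lemma sum_Young:
  assumes "\<And>i. 0 \<le> a i" "\<And>i. 0 \<le> b i"
  shows "(\<Sum>i\<in>I. a i * b i) \<le> (\<Sum>i\<in>I. a i powr p) / p + (\<Sum>i\<in>I. b i powr q) / q"
  unfolding sum_divide_distrib sum.distrib[symmetric]
  by (intro sum_mono Youngs_inequality p q_gt_1 conj_exp assms)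

text \<open>Duality of the p-norm and the q-norm, tested on the extremal vector \<open>?h\<close>,
  whose p-th power is the q-th power of \<open>R g\<close>.\<close>

lemma adjoint_contraction:
  assumes "\<And>i. 0 \<le> g i"
  shows "(\<Sum>i\<in>I. R g i powr q) \<le> (\<Sum>i\<in>I. g i powr q)"
proof -
  let ?h = "\<lambda>j. R g j powr (q - 1)"
  have R: "0 \<le> R g j" for j
    using assms t_nonneg by (intro mat_op_nonneg)
  have hp: "?h j powr p = R g j powr q" for j
    by (simp add: powr_powr q_minus_1)
  have "R g j powr q = R g j * ?h j" for j
    using R[of j] by (cases "R g j = 0") (simp_all add: powr_diff)
  then have "(\<Sum>j\<in>I. R g j powr q) = (\<Sum>i\<in>I. mat_op I t ?h i * g i)"
    by (simp add: mat_op_adjoint mult.commute)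
  also have "\<dots> \<le> (\<Sum>i\<in>I. mat_op I t ?h i powr p) / p + (\<Sum>i\<in>I. g i powr q) / q"
    using assms t_nonneg by (intro sum_Young mat_op_nonneg) auto
  also have "\<dots> \<le> (\<Sum>i\<in>I. R g i powr q) / p + (\<Sum>i\<in>I. g i powr q) / q"
    using contraction[of ?h] p by (simp add: hp divide_right_mono)
  finally have "(\<Sum>j\<in>I. R g j powr q) * (1 - 1 / p) \<le> (\<Sum>i\<in>I. g i powr q) * (1 / q)"
    using p by (simp add: divide_right_mono algebra_simps)
  moreover have "1 - 1 / p = 1 / q" using conj_exp by simp
  ultimately show ?thesis
    using q_gt_1 by (simp add: divide_le_cancel)
qed

section \<open>Horner sums with decreasing coefficients\<close>

context
  fixes G :: "nat \<Rightarrow> 'i \<Rightarrow> real"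
  assumes G_nonneg: "\<And>k i. 0 \<le> G k i" and G_anti: "\<And>k i. G (Suc k) i \<le> G k i"
begin

lemma horner_sum_nonneg: "0 \<le> horner_sum R G m k i"
  by (induction m arbitrary: k i) (simp_all add: G_nonneg t_nonneg mat_op_nonneg)

lemma horner_sum_anti: "horner_sum R G m (Suc k) i \<le> horner_sum R G m k i"
  by (induction m arbitrary: k i) (auto intro!: add_mono G_anti mat_op_mono t_nonneg)

lemma horner_sum_Suc_le: "horner_sum R G m k i \<le> horner_sum R G (Suc m) k i"
proof (induction m arbitrary: k i)
  case 0
  then show ?case using horner_sum_nonneg[of 1 k i] by simp
next
  case (Suc m)
  have "R (horner_sum R G m (Suc k)) i \<le> R (horner_sum R G (Suc m) (Suc k)) i"
    by (rule mat_op_mono[OF t_nonneg Suc])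
  then show ?case by simp
qed

lemma horner_sum_le:
  assumes "m \<le> n"
  shows "horner_sum R G m k i \<le> horner_sum R G n 0 i"
proof -
  have "horner_sum R G m k i \<le> horner_sum R G m 0 i"
    using decseqD[OF decseq_SucI, of "\<lambda>k. horner_sum R G m k i" 0 k] horner_sum_anti by simp
  also have "\<dots> \<le> horner_sum R G n 0 i"
    using incseqD[OF incseq_SucI, of "\<lambda>m. horner_sum R G m 0 i" m n] horner_sum_Suc_le assms by simp
  finally show ?thesis .
qed

text \<open>The induction trades \<open>m\<close> for \<open>k\<close> while \<open>n\<close> stays
  fixed, so that the weight \<open>horner_sum R G n 0\<close> is the same in all summands of the
  telescoping bound.\<close>

lemma horner_sum_powr_le:
  assumes "m \<le> n"
  shows "(\<Sum>j\<in>I. horner_sum R G m k j powr q)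
    \<le> q * (\<Sum>j\<in>I. (\<Sum>i<m. G (k + i) j) * horner_sum R G n 0 j powr (q - 1))"
  using assms
proof (induction m arbitrary: k)
  case (Suc m)
  let ?S = "\<lambda>m k. horner_sum R G m k" and ?B = "\<lambda>j. horner_sum R G n 0 j powr (q - 1)"
  have "?S (Suc m) k j powr q \<le> R (?S m (Suc k)) j powr q + q * (G k j * ?B j)" for j
  proof -
    \<comment> \<open>The tangent at the whole sum, evaluated at its part without the leading
      summand; the two points differ by \<open>G k j\<close>.\<close>
    have "?S (Suc m) k j powr q
        + q * ?S (Suc m) k j powr (q - 1) * (R (?S m (Suc k)) j - ?S (Suc m) k j)
      \<le> R (?S m (Suc k)) j powr q"
      using q_gt_1 horner_sum_nonneg t_nonneg
      by (intro powr_tangent_le mat_op_nonneg) (simp_all del: horner_sum.simps)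
    then have "?S (Suc m) k j powr q \<le> R (?S m (Suc k)) j powr q
        + q * (G k j * ?S (Suc m) k j powr (q - 1))"
      by (simp add: algebra_simps)
    also have "\<dots> \<le> R (?S m (Suc k)) j powr q + q * (G k j * ?B j)"
      using q_gt_1 horner_sum_nonneg[of "Suc m" k j] horner_sum_le[OF Suc.prems, of k j]
      by (intro add_left_mono mult_left_mono powr_mono2 G_nonneg) auto
    finally show ?thesis .
  qed
  then have "(\<Sum>j\<in>I. ?S (Suc m) k j powr q)
      \<le> (\<Sum>j\<in>I. R (?S m (Suc k)) j powr q) + q * (\<Sum>j\<in>I. G k j * ?B j)"
    unfolding sum_distrib_left sum.distrib[symmetric] by (rule sum_mono)
  also have "(\<Sum>j\<in>I. R (?S m (Suc k)) j powr q) \<le> (\<Sum>j\<in>I. ?S m (Suc k) j powr q)"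
    by (intro adjoint_contraction horner_sum_nonneg)
  also have "\<dots> \<le> q * (\<Sum>j\<in>I. (\<Sum>i<m. G (Suc k + i) j) * ?B j)"
    using Suc.IH[of "Suc k"] Suc.prems by simp
  finally show ?case
    by (subst sum.lessThan_Suc_shift) (simp add: algebra_simps sum.distrib)
qed simp

lemma sum_horner_sum_mult:
  "(\<Sum>j\<in>I. horner_sum R G m k j * f j)
    = (\<Sum>i<m. \<Sum>j\<in>I. G (k + i) j * (mat_op I t ^^ i) f j)"
proof (induction m arbitrary: k f)
  case (Suc m)
  have "(\<Sum>j\<in>I. horner_sum R G (Suc m) k j * f j)
      = (\<Sum>j\<in>I. G k j * f j) + (\<Sum>j\<in>I. horner_sum R G m (Suc k) j * mat_op I t f j)"
    by (simp add: algebra_simps sum.distrib flip: mat_op_adjoint)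
  also have "\<dots> = (\<Sum>i<Suc m. \<Sum>j\<in>I. G (k + i) j * (mat_op I t ^^ i) f j)"
    unfolding Suc by (subst sum.lessThan_Suc_shift) (simp add: funpow_swap1)
  finally show ?case .
qed simp

lemma horner_sum_norm_le:
  "(\<Sum>j\<in>I. horner_sum R G n 0 j powr q) \<le> q powr q * (\<Sum>j\<in>I. (\<Sum>i<n. G i j) powr q)"
proof -
  let ?S = "horner_sum R G n 0" and ?H = "\<lambda>j. \<Sum>i<n. G i j"
  \<comment> \<open>This \<open>l\<close> balances Young's inequality: after multiplication by
    \<open>q\<close> its first term is exactly \<open>1 / p\<close> of the left side. Absorbing it
    leaves the factor \<open>q * l powr q = q powr q\<close>, the constant that Hoelder's inequality
    would give.\<close>
  define l where "l = q powr (1 / p)"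
  have l: "l > 0" "l powr p = q"
    using q_gt_1 p by (auto simp: l_def powr_powr)
  have eq: "(?S j powr (q - 1) / l) powr p = ?S j powr q / q" for j
    using l by (simp add: powr_divide powr_powr q_minus_1)
  have "(\<Sum>j\<in>I. ?S j powr q) \<le> q * (\<Sum>j\<in>I. ?H j * ?S j powr (q - 1))"
    using horner_sum_powr_le[of n n 0] by simp
  also have "(\<Sum>j\<in>I. ?H j * ?S j powr (q - 1)) = (\<Sum>j\<in>I. (?S j powr (q - 1) / l) * (l * ?H j))"
    using l by (simp add: field_simps)
  also have "\<dots> \<le> (\<Sum>j\<in>I. (?S j powr (q - 1) / l) powr p) / p + (\<Sum>j\<in>I. (l * ?H j) powr q) / q"
    using l G_nonneg by (intro sum_Young) (auto simp: sum_nonneg)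
  also have "(\<Sum>j\<in>I. (l * ?H j) powr q) = l powr q * (\<Sum>j\<in>I. ?H j powr q)"
    using l G_nonneg by (subst powr_mult) (auto simp: sum_nonneg sum_distrib_left)
  finally have "(\<Sum>j\<in>I. ?S j powr q) * (1 - 1 / p) \<le> l powr q * (\<Sum>j\<in>I. ?H j powr q)"
    unfolding eq using q_gt_1 by (simp add: algebra_simps flip: sum_divide_distrib)
  moreover have "1 - 1 / p = 1 / q" using conj_exp by simp
  ultimately have "(\<Sum>j\<in>I. ?S j powr q) \<le> q * l powr q * (\<Sum>j\<in>I. ?H j powr q)"
    using q_gt_1 by (simp add: field_simps)
  also have "q * l powr q = q powr q"
  proof -
    have "1 + q / p = q" using p by (simp add: q field_simps)
    then show ?thesis using q_gt_1 powr_add[of q 1 "q / p"] by (simp add: l_def powr_powr)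
  qed
  finally show ?thesis .
qed

end

text \<open>A maximum over times is linearized by choosing a time \<open>\<nu> i\<close> for every
  coordinate. The bound is uniform in the choice, so the time at which the maximum is attained may
  be inserted later.\<close>

lemma maximal_inequality:
  assumes f: "\<And>i. 0 \<le> f i" and \<nu>: "\<And>i. \<nu> i \<le> N"
  shows "(\<Sum>i\<in>I. ((\<Sum>k\<le>\<nu> i. (mat_op I t ^^ k) f i) / real (\<nu> i + 1)) powr p)
    \<le> q powr p * (\<Sum>i\<in>I. f i powr p)"
proof -
  define F where "F = (\<lambda>i. (\<Sum>k\<le>\<nu> i. (mat_op I t ^^ k) f i) / real (\<nu> i + 1))"
  \<comment> \<open>The vector dual to \<open>F\<close>: \<open>F i powr p = F i * g i\<close>, and
    the q-th power of \<open>g\<close> is the p-th power of \<open>F\<close>.\<close>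
  define g where "g = (\<lambda>i. F i powr (p - 1))"
  \<comment> \<open>The coefficients of the chosen averages, weighted by \<open>g\<close>; summing
    over \<open>k\<close> gives back \<open>g i\<close>, since \<open>\<nu> i + 1\<close> of them
    are nonzero multiples of equal weight.\<close>
  define G where "G = (\<lambda>k i. if k \<le> \<nu> i then g i / real (\<nu> i + 1) else 0)"
  have F: "0 \<le> F i" for i
    unfolding F_def using mat_op_funpow_nonneg[of t f] t_nonneg f by (simp add: sum_nonneg)
  have G: "0 \<le> G k i" "G (Suc k) i \<le> G k i" for k i
    by (auto simp: G_def g_def)
  have restrict: "(\<Sum>k<Suc N. if k \<le> \<nu> i then a k else 0) = (\<Sum>k\<le>\<nu> i. a k)"
    for i and a :: "nat \<Rightarrow> real"
    using \<nu>[of i] by (subst sum.inter_filter[symmetric]) (auto intro!: sum.cong)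
  have G_sum: "(\<Sum>k<Suc N. G k i) = g i" for i
    unfolding G_def restrict by simp
  let ?S = "horner_sum R G (Suc N) 0"
  have "F i powr p = F i * g i" for i
    using F[of i] by (cases "F i = 0") (simp_all add: g_def powr_diff)
  moreover have "F i * g i = (\<Sum>k<Suc N. G k i * (mat_op I t ^^ k) f i)" for i
  proof -
    have "G k i * (mat_op I t ^^ k) f i
        = (if k \<le> \<nu> i then g i / real (\<nu> i + 1) * (mat_op I t ^^ k) f i else 0)" for k
      by (simp add: G_def)
    then show ?thesis
      by (simp only: restrict) (simp add: F_def sum_distrib_left sum_divide_distrib mult.commute)
  qed
  ultimately have "(\<Sum>i\<in>I. F i powr p) = (\<Sum>i\<in>I. \<Sum>k<Suc N. G k i * (mat_op I t ^^ k) f i)"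
    by simp
  also have "\<dots> = (\<Sum>j\<in>I. ?S j * f j)"
    using sum_horner_sum_mult[where G = G and f = f and m = "Suc N" and k = 0, OF G] by (subst sum.swap) simp
  \<comment> \<open>Moving the factor \<open>q\<close> to \<open>f\<close> lets the dual bound
    \<open>q powr q\<close> cancel; the second term of Young's inequality is then at most the left
    side divided by \<open>q\<close>.\<close>
  also have "\<dots> = (\<Sum>j\<in>I. (q * f j) * (?S j / q))"
    using q_gt_1 by (intro sum.cong) auto
  also have "\<dots> \<le> (\<Sum>j\<in>I. (q * f j) powr p) / p + (\<Sum>j\<in>I. (?S j / q) powr q) / q"
    using q_gt_1 f horner_sum_nonneg[where G = G and m = "Suc N" and k = 0, OF G]
    by (intro sum_Young) (simp_all del: horner_sum.simps)
  also have "(\<Sum>j\<in>I. (q * f j) powr p) = q powr p * (\<Sum>j\<in>I. f j powr p)"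
    using q_gt_1 f by (simp add: powr_mult sum_distrib_left)
  also have "(\<Sum>j\<in>I. (?S j / q) powr q) = (\<Sum>j\<in>I. ?S j powr q) / q powr q"
    using q_gt_1 horner_sum_nonneg[where G = G and m = "Suc N" and k = 0, OF G]
    by (simp add: powr_divide sum_divide_distrib del: horner_sum.simps)
  also have "\<dots> \<le> (\<Sum>j\<in>I. g j powr q)"
    using horner_sum_norm_le[where G = G and n = "Suc N", OF G] q_gt_1
    by (simp add: G_sum divide_le_eq mult.commute del: horner_sum.simps sum.lessThan_Suc)
  also have "(\<Sum>j\<in>I. g j powr q) = (\<Sum>j\<in>I. F j powr p)"
    by (simp add: g_def powr_powr p_minus_1)
  finally have "(\<Sum>i\<in>I. F i powr p) * (1 - 1 / q) \<le> q powr p * (\<Sum>j\<in>I. f j powr p) * (1 / p)"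
    using q_gt_1 by (simp add: divide_right_mono algebra_simps)
  moreover have "1 - 1 / q = 1 / p" using conj_exp by simp
  ultimately show ?thesis
    using p by (simp add: F_def divide_le_cancel)
qed

end

section \<open>The seminorm of Lp\<close>

lemma Lp_norm_nonneg: "0 \<le> Lp_norm M p f"
  by (simp add: Lp_norm_def)

lemma Lp_norm_powr:
  "p > 0 \<Longrightarrow> Lp_norm M p f powr p = (\<integral>\<omega>. norm (f \<omega>) powr p \<partial>M)"
  by (simp add: Lp_norm_def powr_powr)

lemma Lp_norm_le_iff:
  "p > 0 \<Longrightarrow> 0 \<le> c \<Longrightarrow> Lp_norm M p f \<le> c \<longleftrightarrow> (\<integral>\<omega>. norm (f \<omega>) powr p \<partial>M) \<le> c powr p"
  using powr_mono2[of p "Lp_norm M p f" c] powr_less_mono2[of p c "Lp_norm M p f"]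
  by (cases "Lp_norm M p f \<le> c") (auto simp: Lp_norm_nonneg Lp_norm_powr[symmetric])

text \<open>\<open>f\<close> may be any function: if its power is not integrable, the integral is 0
  and so is the left side. Maxima and differences can therefore be compared with a dominating
  function directly, also across different codomains.\<close>

lemma Lp_norm_mono:
  assumes "p > 0" "integrable M (\<lambda>\<omega>. norm (g \<omega>) powr p)" "AE \<omega> in M. norm (f \<omega>) \<le> norm (g \<omega>)"
  shows "Lp_norm M p f \<le> Lp_norm M p g"
  unfolding Lp_norm_def
proof (intro powr_mono2 integral_mono_AE')
  show "AE \<omega> in M. norm (f \<omega>) powr p \<le> norm (g \<omega>) powr p"
    using assms(3) by eventually_elim (use assms(1) in \<open>auto intro: powr_mono2\<close>)
qed (use assms in auto)

text \<open>Minkowski's inequality, obtained by optimizing \<open>l\<close> in the integrated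
  convexity bound. Asking only for a domination of \<open>h\<close> covers sums, differences and
  real-valued maxima at once.\<close>

lemma Lp_norm_triangle:
  assumes p: "1 < p"
    and f: "integrable M (\<lambda>\<omega>. norm (f \<omega>) powr p)" and g: "integrable M (\<lambda>\<omega>. norm (g \<omega>) powr p)"
    and h: "AE \<omega> in M. norm (h \<omega>) \<le> norm (f \<omega>) + norm (g \<omega>)"
  shows "Lp_norm M p h \<le> Lp_norm M p f + Lp_norm M p g"
proof -
  let ?F = "\<integral>\<omega>. norm (f \<omega>) powr p \<partial>M" and ?G = "\<integral>\<omega>. norm (g \<omega>) powr p \<partial>M"
  have F: "?F = Lp_norm M p f powr p" and G: "?G = Lp_norm M p g powr p"
    using p by (simp_all add: Lp_norm_powr)
  have weighted: "(\<integral>\<omega>. norm (h \<omega>) powr p \<partial>M) \<le> (1 - l) powr (1 - p) * ?F + l powr (1 - p) * ?G"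
    if l: "0 < l" "l < 1" for l
  proof -
    have "(\<integral>\<omega>. norm (h \<omega>) powr p \<partial>M)
        \<le> (\<integral>\<omega>. (1 - l) powr (1 - p) * norm (f \<omega>) powr p + l powr (1 - p) * norm (g \<omega>) powr p \<partial>M)"
    proof (intro integral_mono_AE')
      show "AE \<omega> in M. norm (h \<omega>) powr p
          \<le> (1 - l) powr (1 - p) * norm (f \<omega>) powr p + l powr (1 - p) * norm (g \<omega>) powr p"
        using h
      proof eventually_elim
        case (elim \<omega>)
        then have "norm (h \<omega>) powr p \<le> (norm (f \<omega>) + norm (g \<omega>)) powr p"
          using p by (intro powr_mono2) auto
        also have "\<dots> \<le> (1 - l) powr (1 - p) * norm (f \<omega>) powr p + l powr (1 - p) * norm (g \<omega>) powr p"
          using p l by (intro powr_add_le_weighted) auto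
        finally show ?case .
      qed
    qed (use f g in auto)
    then show ?thesis using f g by simp
  qed
  \<comment> \<open>Strictly positive upper bounds \<open>a\<close> and \<open>b\<close> keep the
    optimal weight \<open>b / (a + b)\<close> strictly between 0 and 1 even when one of the norms
    vanishes.\<close>
  have main: "Lp_norm M p h \<le> a + b"
    if a: "Lp_norm M p f \<le> a" "0 < a" and b: "Lp_norm M p g \<le> b" "0 < b" for a b
  proof -
    define l where "l = b / (a + b)"
    have l: "0 < l" "l < 1" "1 - l = a / (a + b)"
      using a b by (auto simp: l_def field_simps)
    have scale: "(c / s) powr (1 - p) * c powr p = c * s powr (p - 1)" if "0 < c" "0 < s" for c s :: real
      using that by (simp add: powr_divide powr_diff)
    have "(\<integral>\<omega>. norm (h \<omega>) powr p \<partial>M) \<le> (1 - l) powr (1 - p) * ?F + l powr (1 - p) * ?G"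
      by (rule weighted[OF l(1,2)])
    also have "\<dots> \<le> (1 - l) powr (1 - p) * a powr p + l powr (1 - p) * b powr p"
      unfolding F G using a b p by (intro add_mono mult_left_mono powr_mono2 Lp_norm_nonneg) auto
    also have "\<dots> = (a + b) * (a + b) powr (p - 1)"
      using scale[of a "a + b"] scale[of b "a + b"] a b
      by (simp only: l(3)) (simp add: l_def algebra_simps)
    also have "\<dots> = (a + b) powr p"
      using a b by (simp add: powr_diff)
    finally show ?thesis
      using p a b by (subst Lp_norm_le_iff) auto
  qed
  show ?thesis
  proof (rule field_le_epsilon)
    fix e :: real assume "0 < e"
    then show "Lp_norm M p h \<le> Lp_norm M p f + Lp_norm M p g + e"
      using main[of "Lp_norm M p f + e / 2" "Lp_norm M p g + e / 2"]
        Lp_norm_nonneg[of M p f] Lp_norm_nonneg[of M p g] by simp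
  qed
qed

lemma Lp_norm_mult:
  fixes f :: "'a \<Rightarrow> 'b::real_normed_field"
  assumes "p > 0"
  shows "Lp_norm M p (\<lambda>\<omega>. c * f \<omega>) = norm c * Lp_norm M p f"
  using assms by (simp add: Lp_norm_def norm_mult powr_mult powr_powr)

lemma Lp_norm_norm: "Lp_norm M p (\<lambda>\<omega>. norm (f \<omega>)) = Lp_norm M p f"
  by (simp add: Lp_norm_def)

lemma integrable_powr_add:
  fixes f g :: "'a \<Rightarrow> 'b::{banach, second_countable_topology}"
  assumes "1 < p" "f \<in> borel_measurable M" "g \<in> borel_measurable M"
    and "integrable M (\<lambda>\<omega>. norm (f \<omega>) powr p)" "integrable M (\<lambda>\<omega>. norm (g \<omega>) powr p)"
  shows "integrable M (\<lambda>\<omega>. norm (f \<omega> + g \<omega>) powr p)"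
proof (rule Bochner_Integration.integrable_bound)
  let ?B = "\<lambda>\<omega>. (1 - 1/2) powr (1 - p) * norm (f \<omega>) powr p + (1/2) powr (1 - p) * norm (g \<omega>) powr p"
  show "integrable M ?B" using assms by simp
  have "norm (f \<omega> + g \<omega>) powr p \<le> ?B \<omega>" for \<omega>
  proof -
    have "norm (f \<omega> + g \<omega>) powr p \<le> (norm (f \<omega>) + norm (g \<omega>)) powr p"
      using assms(1) by (intro powr_mono2 norm_triangle_ineq) auto
    also have "\<dots> \<le> ?B \<omega>"
      using assms(1) by (intro powr_add_le_weighted) auto
    finally show ?thesis .
  qed
  then show "AE \<omega> in M. norm (norm (f \<omega> + g \<omega>) powr p) \<le> norm (?B \<omega>)"
    by (intro AE_I2) (simp add: abs_of_nonneg)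
qed (use assms in measurable)

lemma LpD: "f \<in> Lp M p \<Longrightarrow> f \<in> borel_measurable M"
  "f \<in> Lp M p \<Longrightarrow> integrable M (\<lambda>\<omega>. norm (f \<omega>) powr p)"
  by (auto simp: Lp_def)

lemma Lp_cmult: "f \<in> Lp M p \<Longrightarrow> (\<lambda>\<omega>. c * f \<omega>) \<in> Lp M p"
  by (auto simp: Lp_def norm_mult powr_mult)

lemma Lp_add: "1 < p \<Longrightarrow> f \<in> Lp M p \<Longrightarrow> g \<in> Lp M p \<Longrightarrow> (\<lambda>\<omega>. f \<omega> + g \<omega>) \<in> Lp M p"
  by (auto simp: Lp_def intro: integrable_powr_add)

lemma Lp_diff:
  assumes "1 < p" "f \<in> Lp M p" "g \<in> Lp M p"
  shows "(\<lambda>\<omega>. f \<omega> - g \<omega>) \<in> Lp M p"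
  using Lp_add[OF assms(1,2) Lp_cmult[OF assms(3), of "-1"]] by simp

lemma Lp_zero: "(\<lambda>_. 0) \<in> Lp M p"
  by (simp add: Lp_def)

lemma Lp_sum:
  "1 < p \<Longrightarrow> (\<And>i. i \<in> I \<Longrightarrow> f i \<in> Lp M p) \<Longrightarrow> (\<lambda>\<omega>. \<Sum>i\<in>I. f i \<omega>) \<in> Lp M p"
  by (induction I rule: infinite_finite_induct) (auto intro: Lp_zero Lp_add)

lemma Lp_norm_zero: "Lp_norm M p (\<lambda>_. 0) = 0"
  by (simp add: Lp_norm_def)

lemma Lp_norm_sum_le:
  assumes "1 < p" "finite I" "\<And>i. i \<in> I \<Longrightarrow> f i \<in> Lp M p"
    and "AE \<omega> in M. norm (h \<omega>) \<le> (\<Sum>i\<in>I. norm (f i \<omega>))"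
  shows "Lp_norm M p h \<le> (\<Sum>i\<in>I. Lp_norm M p (f i))"
proof -
  have abs: "(\<lambda>\<omega>. complex_of_real (norm (f i \<omega>))) \<in> Lp M p" if "i \<in> I" for i
    using LpD[OF assms(3)[OF that]] by (simp add: Lp_def)
  have "Lp_norm M p (\<lambda>\<omega>. \<Sum>i\<in>J. complex_of_real (norm (f i \<omega>))) \<le> (\<Sum>i\<in>J. Lp_norm M p (f i))"
    if "J \<subseteq> I" for J
    using finite_subset[OF that assms(2)] that
  proof (induction J rule: finite_induct)
    case (insert i J)
    then have "Lp_norm M p (\<lambda>\<omega>. \<Sum>i\<in>insert i J. complex_of_real (norm (f i \<omega>)))
      \<le> Lp_norm M p (f i) + Lp_norm M p (\<lambda>\<omega>. \<Sum>i\<in>J. complex_of_real (norm (f i \<omega>)))"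
      using abs assms(3)
      by (intro Lp_norm_triangle[OF assms(1)] LpD(2)[OF Lp_sum[OF assms(1)]] LpD(2))
         (auto intro!: norm_triangle_ineq[THEN order_trans])
    then show ?case using insert by simp
  qed (simp add: Lp_norm_zero)
  from this[of I] have "Lp_norm M p (\<lambda>\<omega>. \<Sum>i\<in>I. complex_of_real (norm (f i \<omega>)))
      \<le> (\<Sum>i\<in>I. Lp_norm M p (f i))" by simp
  moreover have "Lp_norm M p h \<le> Lp_norm M p (\<lambda>\<omega>. \<Sum>i\<in>I. complex_of_real (norm (f i \<omega>)))"
  proof (rule Lp_norm_mono)
    show "AE \<omega> in M. norm (h \<omega>) \<le> norm (\<Sum>i\<in>I. complex_of_real (norm (f i \<omega>)))"
      using assms(4) by (simp add: sum_nonneg flip: of_real_sum)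
  qed (use assms(1) abs in \<open>auto intro!: LpD(2) Lp_sum\<close>)
  ultimately show ?thesis by linarith
qed

lemma Lp_norm_cong_AE:
  assumes "p > 0" "f \<in> Lp M p" "g \<in> Lp M p" "AE \<omega> in M. f \<omega> = g \<omega>"
  shows "Lp_norm M p f = Lp_norm M p g"
  using assms by (intro antisym Lp_norm_mono) (auto dest: LpD)

lemma Lp_norm_eq_0_imp_AE:
  assumes "f \<in> Lp M p" "Lp_norm M p f = 0"
  shows "AE \<omega> in M. f \<omega> = 0"
  using assms integral_nonneg_eq_0_iff_AE[of M "\<lambda>\<omega>. norm (f \<omega>) powr p"]
  by (auto simp: Lp_norm_def Lp_def)

lemma Lp_norm_triangle_diff:
  assumes "1 < p" "f \<in> Lp M p" "g \<in> Lp M p" "h \<in> Lp M p"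
  shows "Lp_norm M p (\<lambda>\<omega>. f \<omega> - h \<omega>)
    \<le> Lp_norm M p (\<lambda>\<omega>. f \<omega> - g \<omega>) + Lp_norm M p (\<lambda>\<omega>. g \<omega> - h \<omega>)"
proof (intro Lp_norm_triangle LpD(2) Lp_diff)
  have "norm (f \<omega> - h \<omega>) \<le> norm (f \<omega> - g \<omega>) + norm (g \<omega> - h \<omega>)" for \<omega>
    using norm_triangle_ineq[of "f \<omega> - g \<omega>" "g \<omega> - h \<omega>"] by simp
  then show "AE \<omega> in M. norm (f \<omega> - h \<omega>) \<le> norm (f \<omega> - g \<omega>) + norm (g \<omega> - h \<omega>)"
    by simp
qed (use assms in auto)

text \<open>The series of the p-th powers has finite integral, hence is finite almost everywhere,
  and its terms tend to 0. This plays the part of the Borel-Cantelli lemma: norm decay that is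
  geometric, or of order \<open>1 / n\<close> with \<open>p > 1\<close>, becomes almost everywhere
  convergence.\<close>

lemma AE_tendsto_zero_if_summable_integral:
  fixes f :: "nat \<Rightarrow> 'a \<Rightarrow> 'b::{banach, second_countable_topology}"
  assumes p: "0 < p" and int: "\<And>n. integrable M (\<lambda>\<omega>. norm (f n \<omega>) powr p)"
    and summ: "summable (\<lambda>n. \<integral>\<omega>. norm (f n \<omega>) powr p \<partial>M)"
  shows "AE \<omega> in M. (\<lambda>n. f n \<omega>) \<longlonglongrightarrow> 0"
proof -
  let ?g = "\<lambda>n \<omega>. norm (f n \<omega>) powr p"
  have [measurable]: "?g n \<in> borel_measurable M" for n
    using int by auto
  have "(\<integral>\<^sup>+\<omega>. (\<Sum>n. ennreal (?g n \<omega>)) \<partial>M) = (\<Sum>n. \<integral>\<^sup>+\<omega>. ennreal (?g n \<omega>) \<partial>M)"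
    by (rule nn_integral_suminf) measurable
  also have "\<dots> = (\<Sum>n. ennreal (\<integral>\<omega>. ?g n \<omega> \<partial>M))"
    using int by (simp add: nn_integral_eq_integral)
  also have "\<dots> = ennreal (\<Sum>n. \<integral>\<omega>. ?g n \<omega> \<partial>M)"
    by (intro suminf_ennreal2 summ) simp
  finally have "AE \<omega> in M. (\<Sum>n. ennreal (?g n \<omega>)) \<noteq> \<infinity>"
    by (intro nn_integral_PInf_AE) auto
  then show ?thesis
  proof eventually_elim
    case (elim \<omega>)
    then have "summable (\<lambda>n. ?g n \<omega>)"
      by (intro summable_suminf_not_top) auto
    then have "(\<lambda>n. ?g n \<omega>) \<longlonglongrightarrow> 0"
      by (rule summable_LIMSEQ_zero)
    then have "(\<lambda>n. ?g n \<omega> powr (1 / p)) \<longlonglongrightarrow> 0"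
      using p tendsto_powr'[of "\<lambda>n. ?g n \<omega>" 0 sequentially "\<lambda>_. 1 / p" "1 / p"] by simp
    then show ?case
      using p by (simp add: powr_powr tendsto_norm_zero_iff)
  qed
qed

section \<open>Completeness and uniform convexity\<close>

lemma Lp_complete:
  assumes p: "1 < p" and f: "\<And>n. f n \<in> Lp M p"
    and Cauchy: "\<And>e. 0 < e \<Longrightarrow> \<exists>N. \<forall>m\<ge>N. \<forall>n\<ge>N. Lp_norm M p (\<lambda>\<omega>. f m \<omega> - f n \<omega>) < e"
  shows "\<exists>g\<in>Lp M p. (\<lambda>n. Lp_norm M p (\<lambda>\<omega>. f n \<omega> - g \<omega>)) \<longlonglongrightarrow> 0"
proof -
  note [measurable] = LpD(1)[OF f]
  have diff: "(\<lambda>\<omega>. f m \<omega> - f n \<omega>) \<in> Lp M p" for m n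
    by (intro Lp_diff p f)
  have "\<exists>N. \<forall>m\<ge>N. \<forall>n\<ge>N. Lp_norm M p (\<lambda>\<omega>. f m \<omega> - f n \<omega>) < (1/4) ^ k" for k
    by (rule Cauchy) simp
  then obtain N where N: "\<And>k m n. m \<ge> N k \<Longrightarrow> n \<ge> N k \<Longrightarrow>
      Lp_norm M p (\<lambda>\<omega>. f m \<omega> - f n \<omega>) < (1/4) ^ k"
    by metis
  \<comment> \<open>The sum over all earlier thresholds makes \<open>r\<close> monotone; the summand
    \<open>k\<close> guarantees \<open>r k \<ge> k\<close>, so that the subsequence passes every
    index.\<close>
  define r where "r = (\<lambda>k. k + (\<Sum>j\<le>k. N j))"
  have r_ge: "r k \<ge> N k" "r k \<ge> k" and r_mono: "r k \<le> r (Suc k)" for k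
    by (auto simp: r_def member_le_sum trans_le_add2)
  \<comment> \<open>The increments have norm below \<open>(1/4) ^ k\<close>, so even after scaling
    by \<open>2 ^ k\<close> they tend to 0 almost everywhere; boundedness of \<open>d\<close> at a
    point then makes the increments summable there.\<close>
  define d where "d = (\<lambda>k \<omega>. 2 ^ k * (f (r (Suc k)) \<omega> - f (r k) \<omega>))"
  have d: "d k \<in> Lp M p" for k
    unfolding d_def by (intro Lp_cmult diff)
  have d_norm: "Lp_norm M p (d k) \<le> (1/2) ^ k" for k
  proof -
    have "Lp_norm M p (d k) = 2 ^ k * Lp_norm M p (\<lambda>\<omega>. f (r (Suc k)) \<omega> - f (r k) \<omega>)"
      unfolding d_def using p by (subst Lp_norm_mult) (auto simp: norm_power)
    also have "\<dots> \<le> 2 ^ k * (1/4) ^ k"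
      using N[of k "r (Suc k)" "r k"] r_ge[of k] r_mono[of k] by (intro mult_left_mono) auto
    finally show ?thesis by (simp flip: power_mult_distrib)
  qed
  have "AE \<omega> in M. (\<lambda>k. d k \<omega>) \<longlonglongrightarrow> 0"
  proof (rule AE_tendsto_zero_if_summable_integral)
    show "summable (\<lambda>k. \<integral>\<omega>. norm (d k \<omega>) powr p \<partial>M)"
    proof (rule summable_comparison_test')
      show "summable (\<lambda>k. (1/2 :: real) ^ k)" by (rule summable_geometric) simp
      fix k
      have "(\<integral>\<omega>. norm (d k \<omega>) powr p \<partial>M) \<le> ((1/2) ^ k) powr p"
        using d_norm[of k] p by (subst (asm) Lp_norm_le_iff) auto
      also have "\<dots> \<le> (1/2) ^ k"
        using p powr_mono'[of 1 p "(1/2) ^ k :: real"] by (simp add: power_le_one)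
      finally show "norm (\<integral>\<omega>. norm (d k \<omega>) powr p \<partial>M) \<le> (1/2) ^ k" by simp
    qed
  qed (use p d in \<open>auto dest: LpD\<close>)
  then have conv: "AE \<omega> in M. convergent (\<lambda>k. f (r k) \<omega>)"
  proof eventually_elim
    case (elim \<omega>)
    then obtain B where B: "\<And>k. norm (d k \<omega>) \<le> B"
      by (metis Bseq_def convergentI convergent_imp_Bseq)
    have "summable (\<lambda>k. f (r (Suc k)) \<omega> - f (r k) \<omega>)"
    proof (rule summable_comparison_test')
      show "summable (\<lambda>k. B * (1/2 :: real) ^ k)"
        by (intro summable_mult summable_geometric) simp
      show "norm (f (r (Suc k)) \<omega> - f (r k) \<omega>) \<le> B * (1/2) ^ k" for k
      proof -
        have "2 ^ k * norm (f (r (Suc k)) \<omega> - f (r k) \<omega>) \<le> B"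
          using B[of k] by (simp add: d_def norm_mult norm_power)
        then show ?thesis by (simp add: field_simps power_divide)
      qed
    qed
    then have "convergent (\<lambda>n. \<Sum>k<n. f (r (Suc k)) \<omega> - f (r k) \<omega>)"
      by (simp add: summable_iff_convergent)
    then have "convergent (\<lambda>n. (f (r n) \<omega> - f (r 0) \<omega>) + f (r 0) \<omega>)"
      by (intro convergent_add convergent_const) (simp add: sum_lessThan_telescope[of "\<lambda>k. f (r k) \<omega>"])
    then show ?case by simp
  qed
  define g where "g = (\<lambda>\<omega>. lim (\<lambda>k. f (r k) \<omega>))"
  have [measurable]: "g \<in> borel_measurable M"
    unfolding g_def by (intro borel_measurable_lim_metric) auto
  have lim: "AE \<omega> in M. (\<lambda>k. f (r k) \<omega>) \<longlonglongrightarrow> g \<omega>"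
    using conv by (simp add: g_def convergent_LIMSEQ_iff)
  \<comment> \<open>Fatou's lemma along the subsequence yields the integrability of the difference
    and the norm bound together.\<close>
  have bound: "integrable M (\<lambda>\<omega>. norm (f n \<omega> - g \<omega>) powr p)
      \<and> Lp_norm M p (\<lambda>\<omega>. f n \<omega> - g \<omega>) \<le> e"
    if e: "0 < e" and n: "\<And>m. m \<ge> n \<Longrightarrow> Lp_norm M p (\<lambda>\<omega>. f n \<omega> - f m \<omega>) \<le> e" for n e
  proof -
    have "(\<integral>\<^sup>+\<omega>. ennreal (norm (f n \<omega> - g \<omega>) powr p) \<partial>M)
        = (\<integral>\<^sup>+\<omega>. liminf (\<lambda>k. ennreal (norm (f n \<omega> - f (r k) \<omega>) powr p)) \<partial>M)"
    proof (rule nn_integral_cong_AE)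
      show "AE \<omega> in M. ennreal (norm (f n \<omega> - g \<omega>) powr p)
          = liminf (\<lambda>k. ennreal (norm (f n \<omega> - f (r k) \<omega>) powr p))"
        using lim
      proof eventually_elim
        case (elim \<omega>)
        then have "(\<lambda>k. ennreal (norm (f n \<omega> - f (r k) \<omega>) powr p))
            \<longlonglongrightarrow> ennreal (norm (f n \<omega> - g \<omega>) powr p)"
          using p by (intro tendsto_intros tendsto_ennrealI) auto
        then show ?case by (intro lim_imp_Liminf[symmetric]) auto
      qed
    qed
    also have "\<dots> \<le> liminf (\<lambda>k. \<integral>\<^sup>+\<omega>. ennreal (norm (f n \<omega> - f (r k) \<omega>) powr p) \<partial>M)"
      by (rule nn_integral_liminf) measurable
    also have "\<dots> \<le> ennreal (e powr p)"
    proof (rule order_trans[OF Liminf_le_Limsup Limsup_bounded])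
      have "(\<integral>\<^sup>+\<omega>. ennreal (norm (f n \<omega> - f (r k) \<omega>) powr p) \<partial>M) \<le> ennreal (e powr p)"
        if "k \<ge> n" for k
        using n[of "r k"] r_ge(2)[of k] that e p LpD(2)[OF diff]
        by (subst nn_integral_eq_integral) (auto simp: Lp_norm_le_iff intro!: ennreal_leI)
      then show "\<forall>\<^sub>F k in sequentially.
          (\<integral>\<^sup>+\<omega>. ennreal (norm (f n \<omega> - f (r k) \<omega>) powr p) \<partial>M) \<le> ennreal (e powr p)"
        by (rule eventually_sequentiallyI)
    qed simp
    finally have le: "(\<integral>\<^sup>+\<omega>. ennreal (norm (f n \<omega> - g \<omega>) powr p) \<partial>M) \<le> ennreal (e powr p)" .
    then have int: "integrable M (\<lambda>\<omega>. norm (f n \<omega> - g \<omega>) powr p)"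
      by (intro integrableI_bounded) (auto intro: le_less_trans)
    with le have "(\<integral>\<omega>. norm (f n \<omega> - g \<omega>) powr p \<partial>M) \<le> e powr p"
      by (simp add: nn_integral_eq_integral)
    then show ?thesis using int e p by (simp add: Lp_norm_le_iff)
  qed
  have close: "\<exists>N. \<forall>n\<ge>N. integrable M (\<lambda>\<omega>. norm (f n \<omega> - g \<omega>) powr p)
      \<and> Lp_norm M p (\<lambda>\<omega>. f n \<omega> - g \<omega>) \<le> e" if e: "0 < e" for e
  proof -
    obtain N where "\<forall>m\<ge>N. \<forall>n\<ge>N. Lp_norm M p (\<lambda>\<omega>. f m \<omega> - f n \<omega>) < e"
      using Cauchy[OF e] by blast
    then show ?thesis
      by (intro exI[of _ N] allI impI bound[OF e]) (auto intro: less_imp_le)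
  qed
  obtain N where "integrable M (\<lambda>\<omega>. norm (f N \<omega> - g \<omega>) powr p)"
    using close[of 1] by auto
  then have "(\<lambda>\<omega>. f N \<omega> - g \<omega>) \<in> Lp M p"
    by (simp add: Lp_def)
  from Lp_diff[OF p f[of N] this] have "g \<in> Lp M p" by simp
  moreover have "(\<lambda>n. Lp_norm M p (\<lambda>\<omega>. f n \<omega> - g \<omega>)) \<longlonglongrightarrow> 0"
  proof (rule LIMSEQ_I)
    fix e :: real assume "0 < e"
    then obtain N where "\<forall>n\<ge>N. Lp_norm M p (\<lambda>\<omega>. f n \<omega> - g \<omega>) \<le> e / 2"
      using close[of "e / 2"] by auto
    then show "\<exists>N. \<forall>n\<ge>N. norm (Lp_norm M p (\<lambda>\<omega>. f n \<omega> - g \<omega>) - 0) < e"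
      using \<open>0 < e\<close> by (intro exI[of _ N]) (force simp: Lp_norm_nonneg)
  qed
  ultimately show ?thesis by blast
qed

text \<open>The mean value theorem on the two halves gives two slopes, the one on the right half
  being strictly larger. Differentiability is asked for only inside the interval, which admits
  \<open>x = 0\<close>.\<close>

lemma powr_midpoint_less:
  fixes x y p :: real
  assumes "1 < p" "0 \<le> x" "x < y"
  shows "((x + y) / 2) powr p < (x powr p + y powr p) / 2"
proof -
  let ?s = "(x + y) / 2"
  have mvt: "\<exists>z. u < z \<and> z < v \<and> v powr p - u powr p = (v - u) * (p * z powr (p - 1))"
    if "0 \<le> u" "u < v" for u v
  proof -
    have deriv: "((\<lambda>x. x powr p) has_real_derivative p * z powr (p - 1)) (at z)" if "u < z" for z
      using that \<open>0 \<le> u\<close> by (auto intro!: derivative_eq_intros)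
    have "continuous_on {u..v} (\<lambda>x. x powr p)"
      using that assms(1) by (intro continuous_on_powr' continuous_intros) auto
    moreover have "(\<lambda>x. x powr p) differentiable (at x)" if "u < x" "x < v" for x
      using deriv[OF that(1)] by (auto simp: real_differentiable_def)
    ultimately obtain l z where "u < z" "z < v" "DERIV (\<lambda>x. x powr p) z :> l"
      "v powr p - u powr p = (v - u) * l"
      using MVT[OF \<open>u < v\<close>, of "\<lambda>x. x powr p"] by blast
    then show ?thesis using DERIV_unique[OF _ deriv] by blast
  qed
  obtain z where z: "x < z" "z < ?s" "?s powr p - x powr p = (?s - x) * (p * z powr (p - 1))"
    using mvt[of x ?s] assms by auto
  obtain w where w: "?s < w" "w < y" "y powr p - ?s powr p = (y - ?s) * (p * w powr (p - 1))"
    using mvt[of ?s y] assms by auto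
  have "z powr (p - 1) < w powr (p - 1)"
    using assms z w by (intro powr_less_mono2) auto
  then have "(y - x) / 2 * (p * z powr (p - 1)) < (y - x) / 2 * (p * w powr (p - 1))"
    using assms by simp
  moreover have eq: "?s - x = (y - x) / 2" "y - ?s = (y - x) / 2" by (simp_all add: field_simps)
  ultimately have "?s powr p - x powr p < y powr p - ?s powr p"
    using z(3) w(3) by (simp only: eq)
  have half: "A < (B + C) / 2" if "A - B < C - A" for A B C :: real
    using that by simp
  show ?thesis by (rule half) fact
qed

text \<open>Homogeneous of degree \<open>p\<close> in the pair, which reduces estimates to a compact
  set, and integrable along two functions of Lp, which carries bounds linear in it over to
  norms.\<close>

definition convexity_defect :: "real \<Rightarrow> complex \<Rightarrow> complex \<Rightarrow> real" where
  "convexity_defect p a b = (norm a powr p + norm b powr p) / 2 - norm ((a + b) / 2) powr p"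

lemma continuous_on_norm_powr:
  fixes f :: "'a::topological_space \<Rightarrow> 'b::real_normed_vector"
  assumes "0 < p" "continuous_on S f"
  shows "continuous_on S (\<lambda>x. norm (f x) powr p)"
  using assms by (intro continuous_on_powr' continuous_intros) auto

text \<open>For equal moduli strictness comes from the triangle inequality, whose equality case
  forces equal directions; for different moduli it comes from strict convexity of the power.\<close>

lemma convexity_defect_pos:
  assumes p: "1 < p" and "a \<noteq> b"
  shows "0 < convexity_defect p a b"
proof (cases "norm a = norm b")
  case True
  have "norm (a + b) \<noteq> norm a + norm b"
  proof
    assume "norm (a + b) = norm a + norm b"
    then have "norm a *\<^sub>R b = norm b *\<^sub>R a"
      by (simp only: norm_triangle_eq)
    then show False using True \<open>a \<noteq> b\<close> by auto
  qed
  then have "norm ((a + b) / 2) < norm a"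
    using norm_triangle_ineq[of a b] True by (simp add: norm_divide)
  then have "norm ((a + b) / 2) powr p < norm a powr p"
    using p by (intro powr_less_mono2) auto
  then show ?thesis using True by (simp add: convexity_defect_def)
next
  case False
  have "norm ((a + b) / 2) powr p \<le> ((norm a + norm b) / 2) powr p"
    using p by (intro powr_mono2) (auto simp: norm_divide norm_triangle_ineq)
  also have "\<dots> < (norm a powr p + norm b powr p) / 2"
    using False powr_midpoint_less[OF p, of "norm a" "norm b"]
      powr_midpoint_less[OF p, of "norm b" "norm a"]
    by (cases "norm a < norm b") (auto simp: add.commute)
  finally show ?thesis by (simp add: convexity_defect_def)
qed

lemma convexity_defect_nonneg: "1 < p \<Longrightarrow> 0 \<le> convexity_defect p a b"
  using convexity_defect_pos[of p a b] by (cases "a = b") (auto simp: convexity_defect_def)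

text \<open>A compactness argument in place of Clarkson's inequalities, which treats all
  \<open>p > 1\<close> alike. Either the distance is small relative to the moduli and the first term
  suffices, or the normalized pair lies in a compact set on which the defect has a positive
  minimum.\<close>

lemma uniform_convexity_complex:
  assumes p: "1 < p" and \<eta>: "0 < \<eta>"
  shows "\<exists>K\<ge>0. \<forall>a b :: complex. norm (a - b) powr p
    \<le> \<eta> * (norm a powr p + norm b powr p) + K * convexity_defect p a b"
proof -
  \<comment> \<open>Points with normalized powers lie in the two balls; naming the balls makes
    compactness evident.\<close>
  define S where "S = (cball 0 1 \<times> cball 0 1) \<inter> {x :: complex \<times> complex.
      norm (fst x) powr p + norm (snd x) powr p = 1 \<and> \<eta> \<le> norm (fst x - snd x) powr p}"
  have "compact S"
    unfolding S_def using p
    by (intro compact_Int_closed compact_Times compact_cball closed_Collect_conj closed_Collect_eq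
        closed_Collect_le continuous_on_norm_powr continuous_intros) auto
  moreover have "continuous_on S (\<lambda>x. convexity_defect p (fst x) (snd x))"
    unfolding convexity_defect_def using p
    by (intro continuous_on_norm_powr continuous_intros) auto
  ultimately obtain \<delta> where \<delta>: "0 < \<delta>" "\<And>x. x \<in> S \<Longrightarrow> \<delta> \<le> convexity_defect p (fst x) (snd x)"
  proof (cases "S = {}")
    case False
    with \<open>compact S\<close> obtain x0 where x0: "x0 \<in> S"
      "\<And>x. x \<in> S \<Longrightarrow> convexity_defect p (fst x0) (snd x0) \<le> convexity_defect p (fst x) (snd x)"
      using continuous_attains_inf[OF \<open>compact S\<close> _ \<open>continuous_on S _\<close>] by blast
    moreover have "fst x0 \<noteq> snd x0"
      using x0(1) \<eta> by (auto simp: S_def)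
    ultimately show ?thesis
      using that convexity_defect_pos[OF p] by blast
  qed (use that[of 1] in auto)
  \<comment> \<open>The constant combines two bounds: with \<open>s\<close> the sum of the powers of
    the moduli, the left side is at most \<open>2 powr p * s\<close>, and \<open>s\<close> is at
    most the defect divided by \<open>\<delta>\<close> outside the trivial case.\<close>
  have "norm (a - b) powr p \<le> \<eta> * (norm a powr p + norm b powr p) + 2 powr p / \<delta> * convexity_defect p a b"
    for a b :: complex
  proof (cases "norm (a - b) powr p \<le> \<eta> * (norm a powr p + norm b powr p)")
    case True
    then show ?thesis
      using convexity_defect_nonneg[OF p, of a b] \<delta>(1) by (simp add: add_increasing2)
  next
    case False
    define s where "s = norm a powr p + norm b powr p"
    have "s \<noteq> 0" using False by (auto simp: s_def add_nonneg_eq_0_iff)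
    then have s: "s > 0" using add_nonneg_nonneg[OF powr_ge_zero powr_ge_zero, of "norm a" p "norm b" p]
      unfolding s_def by linarith
    define c where "c = s powr (1 / p)"
    have c: "c > 0" "c powr p = s" using s p by (auto simp: c_def powr_powr)
    have scale: "norm (z / of_real c) powr p = norm z powr p / s" for z :: complex
      using c by (simp add: norm_divide powr_divide)
    have le1: "norm z \<le> c" if "norm z powr p \<le> s" for z :: complex
      using that c p powr_less_mono2[of p c "norm z"] by (cases "norm z \<le> c") auto
    have "norm (a / of_real c) \<le> 1" "norm (b / of_real c) \<le> 1"
      using le1[of a] le1[of b] c(1) by (simp_all add: norm_divide s_def)
    moreover have "norm (a / of_real c) powr p + norm (b / of_real c) powr p = 1"
      unfolding scale using s by (simp add: s_def flip: add_divide_distrib)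
    moreover have "\<eta> \<le> norm (a / of_real c - b / of_real c) powr p"
      unfolding diff_divide_distrib[symmetric] scale using s False
      by (simp add: s_def field_simps)
    ultimately have "(a / of_real c, b / of_real c) \<in> S"
      by (simp add: S_def)
    from \<delta>(2)[OF this] have "\<delta> \<le> convexity_defect p (a / of_real c) (b / of_real c)"
      by simp
    also have "\<dots> = convexity_defect p a b / s"
    proof -
      have "(a / of_real c + b / of_real c) / 2 = ((a + b) / 2) / of_real c"
        by (simp add: add_divide_distrib mult.commute)
      then show ?thesis
        unfolding convexity_defect_def
        by (simp only: scale) (simp add: diff_divide_distrib add_divide_distrib mult.commute)
    qed
    finally have "\<delta> \<le> convexity_defect p a b / s" .
    then have "s \<le> convexity_defect p a b / \<delta>"
      using s \<delta>(1) by (simp add: field_simps)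
    moreover have "norm (a - b) powr p \<le> 2 powr p * s"
    proof -
      have "norm (a - b) \<le> 2 * c"
        using norm_triangle_ineq4[of a b] le1[of a] le1[of b] by (simp add: s_def)
      then have "norm (a - b) powr p \<le> (2 * c) powr p"
        using p by (intro powr_mono2) auto
      then show ?thesis using c by (simp add: powr_mult)
    qed
    ultimately have "norm (a - b) powr p \<le> 2 powr p * (convexity_defect p a b / \<delta>)"
      by (smt (verit) mult_left_mono powr_ge_zero)
    then show ?thesis using \<eta> by (simp add: add_increasing)
  qed
  then show ?thesis using \<delta>(1) by (intro exI[of _ "2 powr p / \<delta>"]) auto
qed

lemma Lp_uniform_convexity:
  assumes p: "1 < p" and \<eta>: "0 < \<eta>"
  shows "\<exists>K\<ge>0. \<forall>f\<in>Lp M p. \<forall>g\<in>Lp M p. Lp_norm M p (\<lambda>\<omega>. f \<omega> - g \<omega>) powr p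
    \<le> \<eta> * (Lp_norm M p f powr p + Lp_norm M p g powr p)
      + K * ((Lp_norm M p f powr p + Lp_norm M p g powr p) / 2
             - Lp_norm M p (\<lambda>\<omega>. (f \<omega> + g \<omega>) / 2) powr p)"
proof -
  obtain K where K: "K \<ge> 0" "\<And>a b :: complex. norm (a - b) powr p
    \<le> \<eta> * (norm a powr p + norm b powr p) + K * convexity_defect p a b"
    using uniform_convexity_complex[OF p \<eta>] by blast
  have "Lp_norm M p (\<lambda>\<omega>. f \<omega> - g \<omega>) powr p
    \<le> \<eta> * (Lp_norm M p f powr p + Lp_norm M p g powr p)
      + K * ((Lp_norm M p f powr p + Lp_norm M p g powr p) / 2
             - Lp_norm M p (\<lambda>\<omega>. (f \<omega> + g \<omega>) / 2) powr p)"
    if f: "f \<in> Lp M p" and g: "g \<in> Lp M p" for f g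
  proof -
    have half: "(\<lambda>\<omega>. (f \<omega> + g \<omega>) / 2) \<in> Lp M p"
      using Lp_cmult[OF Lp_add[OF p f g], of "1/2"] by simp
    note [simp] = LpD(2)[OF f] LpD(2)[OF g] LpD(2)[OF half]
    have int: "integrable M (\<lambda>\<omega>. convexity_defect p (f \<omega>) (g \<omega>))"
      by (simp add: convexity_defect_def del: norm_divide_numeral)
    have "(\<integral>\<omega>. norm (f \<omega> - g \<omega>) powr p \<partial>M) \<le> (\<integral>\<omega>. \<eta> * (norm (f \<omega>) powr p + norm (g \<omega>) powr p)
        + K * convexity_defect p (f \<omega>) (g \<omega>) \<partial>M)"
      using K(2) int LpD(2)[OF Lp_diff[OF p f g]] by (intro integral_mono) auto
    also have "\<dots> = \<eta> * ((\<integral>\<omega>. norm (f \<omega>) powr p \<partial>M) + (\<integral>\<omega>. norm (g \<omega>) powr p \<partial>M))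
        + K * (\<integral>\<omega>. convexity_defect p (f \<omega>) (g \<omega>) \<partial>M)"
      using int by simp
    also have "(\<integral>\<omega>. convexity_defect p (f \<omega>) (g \<omega>) \<partial>M)
        = ((\<integral>\<omega>. norm (f \<omega>) powr p \<partial>M) + (\<integral>\<omega>. norm (g \<omega>) powr p \<partial>M)) / 2
          - (\<integral>\<omega>. norm ((f \<omega> + g \<omega>) / 2) powr p \<partial>M)"
      by (simp add: convexity_defect_def del: norm_divide_numeral)
    finally show ?thesis
      using p by (simp add: Lp_norm_powr del: norm_divide_numeral)
  qed
  with K(1) show ?thesis by blast
qed

section \<open>Discretization\<close>

lemma Lp_dominated:
  assumes "p > 0" "g \<in> Lp M p" "h \<in> borel_measurable M" "AE \<omega> in M. norm (h \<omega>) \<le> norm (g \<omega>)"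
  shows "h \<in> Lp M p"
proof -
  have "AE \<omega> in M. norm (h \<omega>) powr p \<le> norm (g \<omega>) powr p"
    using assms(4) by eventually_elim (use assms(1) in \<open>auto intro: powr_mono2\<close>)
  then have "integrable M (\<lambda>\<omega>. norm (h \<omega>) powr p)"
    using assms LpD[OF assms(2)] by (intro Bochner_Integration.integrable_bound[OF LpD(2)[OF assms(2)]]) auto
  then show ?thesis using assms(3) by (simp add: Lp_def)
qed

lemma Lp_norm_fun: "f \<in> Lp M p \<Longrightarrow> (\<lambda>\<omega>. complex_of_real (norm (f \<omega>))) \<in> Lp M p"
  by (auto simp: Lp_def)

lemma Lp_Max:
  assumes "1 < p" "finite I" "I \<noteq> {}" "\<And>i. i \<in> I \<Longrightarrow> f i \<in> Lp M p"
  shows "(\<lambda>\<omega>. complex_of_real (MAX i\<in>I. norm (f i \<omega>))) \<in> Lp M p"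
proof (rule Lp_dominated)
  show "(\<lambda>\<omega>. \<Sum>i\<in>I. complex_of_real (norm (f i \<omega>))) \<in> Lp M p"
    using assms by (intro Lp_sum Lp_norm_fun)
  have "(MAX i\<in>I. norm (f i \<omega>)) \<le> (\<Sum>i\<in>I. norm (f i \<omega>))" for \<omega>
    using assms by (intro Max.boundedI) (auto intro: member_le_sum)
  moreover have "0 \<le> (MAX i\<in>I. norm (f i \<omega>))" for \<omega>
    using assms by (auto simp: Max_ge_iff)
  ultimately show "AE \<omega> in M. norm (complex_of_real (MAX i\<in>I. norm (f i \<omega>)))
      \<le> norm (\<Sum>i\<in>I. complex_of_real (norm (f i \<omega>)))"
    by (intro AE_I2) (simp add: sum_nonneg flip: of_real_sum)
  show "(\<lambda>\<omega>. complex_of_real (MAX i\<in>I. norm (f i \<omega>))) \<in> borel_measurable M"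
    using assms(2) LpD(1)[OF assms(4)]
    by measurable
qed (use assms in simp)

text \<open>The sets need not cover the space, whose measure may be infinite. Finite nonzero measure
  makes the mean value over each of them meaningful.\<close>

locale finite_partition =
  fixes M :: "'a measure" and p :: real and n :: nat and A :: "nat \<Rightarrow> 'a set"
  assumes p: "1 < p"
    and sets [measurable]: "\<And>i. i < n \<Longrightarrow> A i \<in> sets M"
    and finite: "\<And>i. i < n \<Longrightarrow> emeasure M (A i) \<noteq> \<infinity>"
    and pos: "\<And>i. i < n \<Longrightarrow> 0 < measure M (A i)"
    and disj: "\<And>i j. i < n \<Longrightarrow> j < n \<Longrightarrow> i \<noteq> j \<Longrightarrow> A i \<inter> A j = {}"
begin

text \<open>The normalization makes \<open>step\<close> an isometry from the p-norm on
  \<open>n\<close> coordinates into Lp.\<close>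

definition step :: "(nat \<Rightarrow> complex) \<Rightarrow> 'a \<Rightarrow> complex" where
  "step c = (\<lambda>\<omega>. \<Sum>i<n. c i * (indicator (A i) \<omega> * of_real (measure M (A i) powr (- 1 / p))))"

text \<open>The power of the measure is the one that makes \<open>coord\<close> a left inverse of
  \<open>step\<close>. The composition \<open>step (coord f)\<close> takes on \<open>A i\<close> the
  mean value of \<open>f\<close> over \<open>A i\<close>, so it is a conditional expectation cut off
  outside the partition.\<close>

definition coord :: "('a \<Rightarrow> complex) \<Rightarrow> nat \<Rightarrow> complex" where
  "coord f i = of_real (measure M (A i) powr (1 / p - 1)) * (LINT \<omega>:A i|M. f \<omega>)"

lemma step_on:
  assumes "i < n" "\<omega> \<in> A i"
  shows "step c \<omega> = c i * of_real (measure M (A i) powr (- 1 / p))"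
proof -
  have "step c \<omega> = (\<Sum>j<n. if j = i then c i * of_real (measure M (A i) powr (- 1 / p)) else 0)"
    unfolding step_def using assms disj[of i] by (intro sum.cong) (auto simp: indicator_def)
  then show ?thesis using assms by simp
qed

lemma step_off: "(\<And>i. i < n \<Longrightarrow> \<omega> \<notin> A i) \<Longrightarrow> step c \<omega> = 0"
  by (simp add: step_def)

lemma step_cong: "(\<And>i. i < n \<Longrightarrow> c i = d i) \<Longrightarrow> step c = step d"
  by (simp add: step_def)

lemma step_sum: "step (\<lambda>i. \<Sum>j\<in>J. c j i) \<omega> = (\<Sum>j\<in>J. step (c j) \<omega>)"
  unfolding step_def by (simp add: sum_distrib_right sum.swap[of _ J])

lemma step_diff: "step (\<lambda>i. c i - d i) \<omega> = step c \<omega> - step d \<omega>"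
  unfolding step_def by (simp add: sum_subtractf algebra_simps)

lemma step_mult: "step (\<lambda>i. a * c i) \<omega> = a * step c \<omega>"
  unfolding step_def by (simp add: sum_distrib_left algebra_simps)

lemma step_mono:
  assumes "\<And>i. i < n \<Longrightarrow> norm (c i) \<le> norm (d i)"
  shows "norm (step c \<omega>) \<le> norm (step d \<omega>)"
proof (cases "\<exists>i<n. \<omega> \<in> A i")
  case True
  then show ?thesis using assms by (auto simp: step_on norm_mult mult_right_mono)
qed (auto simp: step_off)

lemma norm_step_powr:
  "norm (step c \<omega>) powr p = (\<Sum>i<n. norm (c i) powr p * (indicator (A i) \<omega> / measure M (A i)))"
proof (cases "\<exists>i<n. \<omega> \<in> A i")
  case True
  then obtain i where i: "i < n" "\<omega> \<in> A i" by blast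
  have "(\<Sum>j<n. norm (c j) powr p * (indicator (A j) \<omega> / measure M (A j)))
      = (\<Sum>j<n. if j = i then norm (c i) powr p / measure M (A i) else 0)"
    using i disj[of i] by (intro sum.cong) (auto simp: indicator_def)
  also have "\<dots> = norm (c i) powr p * (measure M (A i) powr (- 1 / p)) powr p"
    using i p pos[of i] by (simp add: powr_powr powr_minus_divide powr_divide)
  also have "\<dots> = norm (step c \<omega>) powr p"
    unfolding step_on[OF i] norm_mult norm_of_real abs_of_nonneg[OF powr_ge_zero]
    by (simp add: powr_mult)
  finally show ?thesis by simp
qed (auto simp: step_off)

lemma step_measurable [measurable]: "step c \<in> borel_measurable M"
  unfolding step_def by measurable

lemma step_Lp: "step c \<in> Lp M p"
  using finite by (auto simp: Lp_def norm_step_powr top.not_eq_extremum)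

lemma Lp_norm_step: "Lp_norm M p (step c) powr p = (\<Sum>i<n. norm (c i) powr p)"
proof -
  have "Lp_norm M p (step c) powr p
      = (\<integral>\<omega>. (\<Sum>i<n. norm (c i) powr p * (indicator (A i) \<omega> / measure M (A i))) \<partial>M)"
    using p by (simp add: Lp_norm_powr norm_step_powr)
  also have "\<dots> = (\<Sum>i<n. \<integral>\<omega>. norm (c i) powr p * (indicator (A i) \<omega> / measure M (A i)) \<partial>M)"
    using finite by (intro Bochner_Integration.integral_sum) (auto simp: top.not_eq_extremum)
  also have "\<dots> = (\<Sum>i<n. norm (c i) powr p)"
    using pos by (intro sum.cong) (auto dest: pos)
  finally show ?thesis .
qed

lemma Lp_norm_step_le_iff:
  "Lp_norm M p (step c) \<le> Lp_norm M p f \<longleftrightarrow> (\<Sum>i<n. norm (c i) powr p) \<le> Lp_norm M p f powr p"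
  using p Lp_norm_le_iff[of p "Lp_norm M p f" M "step c"] Lp_norm_step[of c]
  by (simp add: Lp_norm_nonneg Lp_norm_powr)

lemma set_integrable_Lp:
  assumes "f \<in> Lp M p" "i < n"
  shows "set_integrable M (A i) f"
proof -
  have "integrable M (\<lambda>\<omega>. indicator (A i) \<omega> + norm (f \<omega>) powr p)"
    using LpD(2)[OF assms(1)] finite assms(2) by (auto simp: top.not_eq_extremum)
  then show ?thesis
    unfolding set_integrable_def
  proof (rule Bochner_Integration.integrable_bound)
    have "r \<le> 1 + r powr p" if "0 \<le> r" for r :: real
    proof (cases "r \<le> 1")
      case False
      then show ?thesis using p powr_mono[of 1 p r] by simp
    qed (simp add: add_increasing2)
    then show "AE \<omega> in M. norm (indicator (A i) \<omega> *\<^sub>R f \<omega>) \<le> norm (indicator (A i) \<omega> + norm (f \<omega>) powr p)"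
      by (intro AE_I2) (auto simp: indicator_def)
  qed (use LpD(1)[OF assms(1)] assms(2) in measurable)
qed

lemma coord_mono:
  assumes "f \<in> Lp M p" "(\<lambda>\<omega>. complex_of_real (g \<omega>)) \<in> Lp M p" "i < n" "AE \<omega> in M. norm (f \<omega>) \<le> g \<omega>"
  shows "norm (coord f i) \<le> norm (coord (\<lambda>\<omega>. complex_of_real (g \<omega>)) i)"
proof -
  note int = set_integrable_Lp[OF assms(1,3)] set_integrable_Lp[OF assms(2,3)]
  have int': "set_integrable M (A i) g"
    using integrable_Re[OF int(2)[unfolded set_integrable_def]] by (simp add: set_integrable_def)
  have "norm (LINT \<omega>:A i|M. f \<omega>) \<le> (LINT \<omega>:A i|M. norm (f \<omega>))"
    using int(1) by (rule set_integral_norm_bound)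
  also have "\<dots> \<le> (LINT \<omega>:A i|M. g \<omega>)"
    unfolding set_lebesgue_integral_def using int(1) int' assms(4)
    by (intro integral_mono_AE set_integrable_norm[unfolded set_integrable_def])
       (auto simp: set_integrable_def indicator_def)
  also have "\<dots> \<le> norm (LINT \<omega>:A i|M. complex_of_real (g \<omega>))"
    by (simp add: set_integral_complex_of_real)
  finally show ?thesis
    by (simp add: coord_def norm_mult mult_left_mono)
qed

lemma coord_cong_AE:
  assumes "f \<in> borel_measurable M" "g \<in> borel_measurable M" "i < n" "AE \<omega> in M. f \<omega> = g \<omega>"
  shows "coord f i = coord g i"
  unfolding coord_def set_lebesgue_integral_def
  by (intro arg_cong2[of _ _ _ _ "(*)"] refl integral_cong_AE)
     (use assms in \<open>auto intro!: borel_measurable_scaleR borel_measurable_indicator\<close>)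

lemma coord_add:
  "f \<in> Lp M p \<Longrightarrow> g \<in> Lp M p \<Longrightarrow> i < n \<Longrightarrow> coord (\<lambda>\<omega>. f \<omega> + g \<omega>) i = coord f i + coord g i"
  unfolding coord_def by (simp add: set_integral_add set_integrable_Lp distrib_left)

lemma coord_diff:
  "f \<in> Lp M p \<Longrightarrow> g \<in> Lp M p \<Longrightarrow> i < n \<Longrightarrow> coord (\<lambda>\<omega>. f \<omega> - g \<omega>) i = coord f i - coord g i"
  unfolding coord_def by (simp add: set_integral_diff set_integrable_Lp right_diff_distrib)

lemma coord_cmult: "coord (\<lambda>\<omega>. a * f \<omega>) i = a * coord f i"
  unfolding coord_def by simp

lemma coord_sum:
  assumes "i < n" "\<And>j. j \<in> J \<Longrightarrow> f j \<in> Lp M p"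
  shows "coord (\<lambda>\<omega>. \<Sum>j\<in>J. f j \<omega>) i = (\<Sum>j\<in>J. coord (f j) i)"
  using assms(2)
proof (induction J rule: infinite_finite_induct)
  case (insert j J)
  then show ?case using assms(1) by (simp add: coord_add Lp_sum[OF p])
qed (simp_all add: coord_def)

lemma coord_step:
  assumes "i < n"
  shows "coord (step c) i = c i"
proof -
  have "(LINT \<omega>:A i|M. step c \<omega>) = (LINT \<omega>:A i|M. c i * of_real (measure M (A i) powr (- 1 / p)))"
    using assms by (intro set_lebesgue_integral_cong) (auto simp: step_on)
  also have "\<dots> = measure M (A i) *\<^sub>R (c i * of_real (measure M (A i) powr (- 1 / p)))"
    using assms finite by (subst set_integral_const) (auto simp: top.not_eq_extremum)
  finally have "coord (step c) i = c i * of_real (measure M (A i) powr (1 / p - 1)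
      * (measure M (A i) powr (- 1 / p) * measure M (A i)))"
    by (simp add: coord_def scaleR_conv_of_real mult_ac)
  also have "measure M (A i) powr (1 / p - 1) * (measure M (A i) powr (- 1 / p) * measure M (A i))
      = measure M (A i) powr (1 / p - 1) * measure M (A i) powr (- 1 / p) * measure M (A i) powr 1"
    using pos[OF assms] by simp
  also have "\<dots> = 1"
    unfolding powr_add[symmetric] using pos[OF assms] by simp
  finally show ?thesis by simp
qed

text \<open>Jensen's inequality on \<open>A i\<close>: the tangent at the mean value
  \<open>m\<close> of the modulus is integrated, and its linear term integrates to 0.\<close>

lemma coord_powr_le:
  assumes f: "f \<in> Lp M p" and i: "i < n"
  shows "norm (coord f i) powr p \<le> (LINT \<omega>:A i|M. norm (f \<omega>) powr p)"
proof -
  let ?\<mu> = "measure M (A i)"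
  note int = set_integrable_Lp[OF f i]
  define m where "m = (LINT \<omega>:A i|M. norm (f \<omega>)) / ?\<mu>"
  have "0 \<le> (LINT \<omega>:A i|M. norm (f \<omega>))"
    unfolding set_lebesgue_integral_def by simp
  then have m: "0 \<le> m" using pos[OF i] by (simp add: m_def)
  let ?D = "p * m powr (p - 1)"
  have intn: "set_integrable M (A i) (\<lambda>\<omega>. norm (f \<omega>))"
    using int by (rule set_integrable_norm)
  have intc: "set_integrable M (A i) (\<lambda>_. c)" for c :: real
    unfolding set_integrable_def using finite[OF i] i by (auto simp: top.not_eq_extremum)
  have intp: "set_integrable M (A i) (\<lambda>\<omega>. norm (f \<omega>) powr p)"
    unfolding set_integrable_def using LpD(2)[OF f] i
    by (intro integrable_mult_indicator) auto
  have const: "(LINT \<omega>:A i|M. c) = ?\<mu> * c" for c :: real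
    using finite[OF i] i by (subst set_integral_const) (auto simp: top.not_eq_extremum)
  have "(LINT \<omega>:A i|M. m powr p + ?D * (norm (f \<omega>) - m)) \<le> (LINT \<omega>:A i|M. norm (f \<omega>) powr p)"
    using p m by (intro set_integral_mono set_integral_add set_integrable_mult_right set_integral_diff
        intc intn intp powr_tangent_le) auto
  moreover have "(LINT \<omega>:A i|M. m powr p + ?D * (norm (f \<omega>) - m)) = ?\<mu> * m powr p"
  proof -
    have "(LINT \<omega>:A i|M. m powr p + ?D * (norm (f \<omega>) - m))
       = (LINT \<omega>:A i|M. m powr p) + ?D * ((LINT \<omega>:A i|M. norm (f \<omega>)) - (LINT \<omega>:A i|M. m))"
      by (simp add: set_integral_add set_integral_diff intc intn)
    also have "(LINT \<omega>:A i|M. norm (f \<omega>)) = ?\<mu> * m"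
      using pos[OF i] by (simp add: m_def)
    finally show ?thesis by (simp add: const)
  qed
  moreover have "norm (coord f i) powr p \<le> ?\<mu> * m powr p"
  proof -
    have "norm (coord f i) \<le> ?\<mu> powr (1 / p - 1) * (LINT \<omega>:A i|M. norm (f \<omega>))"
      using set_integral_norm_bound[OF int] by (simp add: coord_def norm_mult mult_left_mono)
    also have "\<dots> = ?\<mu> powr (1 / p) * m"
      using pos[OF i] by (simp add: m_def powr_diff)
    finally have "norm (coord f i) powr p \<le> (?\<mu> powr (1 / p) * m) powr p"
      using p by (intro powr_mono2) auto
    then show ?thesis using p pos[OF i] m by (simp add: powr_mult powr_powr)
  qed
  ultimately show ?thesis by simp
qed

lemma sum_coord_powr_le:
  assumes "f \<in> Lp M p"
  shows "(\<Sum>i<n. norm (coord f i) powr p) \<le> Lp_norm M p f powr p"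
proof -
  have intp: "integrable M (\<lambda>\<omega>. indicator (A i) \<omega> * norm (f \<omega>) powr p)" if "i < n" for i
    using integrable_mult_indicator[OF sets[OF that] LpD(2)[OF assms]] by simp
  have "(\<Sum>i<n. norm (coord f i) powr p) \<le> (\<Sum>i<n. \<integral>\<omega>. indicator (A i) \<omega> * norm (f \<omega>) powr p \<partial>M)"
    using coord_powr_le[OF assms] by (intro sum_mono) (auto simp: set_lebesgue_integral_def)
  also have "\<dots> = (\<integral>\<omega>. (\<Sum>i<n. indicator (A i) \<omega> * norm (f \<omega>) powr p) \<partial>M)"
    using intp by (subst Bochner_Integration.integral_sum) auto
  also have "\<dots> \<le> (\<integral>\<omega>. norm (f \<omega>) powr p \<partial>M)"
  proof (rule integral_mono)
    show "integrable M (\<lambda>\<omega>. \<Sum>i<n. indicator (A i) \<omega> * norm (f \<omega>) powr p)"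
      using intp by (intro Bochner_Integration.integrable_sum) auto
    fix \<omega>
    have "disjoint_family_on A {..<n}"
      using disj by (auto simp: disjoint_family_on_def)
    then have "(\<Sum>i<n. indicator (A i) \<omega>) = (indicator (\<Union>i<n. A i) \<omega> :: real)"
      by (simp add: indicator_UN_disjoint)
    then have "(\<Sum>i<n. indicator (A i) \<omega> * norm (f \<omega>) powr p)
        = indicator (\<Union>i<n. A i) \<omega> * norm (f \<omega>) powr p"
      by (simp flip: sum_distrib_right)
    then show "(\<Sum>i<n. indicator (A i) \<omega> * norm (f \<omega>) powr p) \<le> norm (f \<omega>) powr p"
      by (cases "\<omega> \<in> (\<Union>i<n. A i)") (simp_all only: indicator_simps simp_thms, simp_all)
  qed (rule LpD(2)[OF assms])
  also have "\<dots> = Lp_norm M p f powr p"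
    using p by (simp add: Lp_norm_powr)
  finally show ?thesis .
qed

lemma Lp_norm_step_coord_le: "f \<in> Lp M p \<Longrightarrow> Lp_norm M p (step (coord f)) \<le> Lp_norm M p f"
  by (simp add: Lp_norm_step_le_iff sum_coord_powr_le)

text \<open>Averaging is a contractive projection that fixes \<open>step c\<close>, so its error on
  \<open>f\<close> equals its error on the remainder \<open>f - step c\<close>. Hence one good step
  function suffices, and no limit along refining partitions is taken.\<close>

lemma Lp_norm_step_coord_diff_le:
  assumes f: "f \<in> Lp M p"
  shows "Lp_norm M p (\<lambda>\<omega>. step (coord f) \<omega> - f \<omega>) \<le> 2 * Lp_norm M p (\<lambda>\<omega>. f \<omega> - step c \<omega>)"
proof -
  let ?r = "\<lambda>\<omega>. f \<omega> - step c \<omega>"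
  have r: "?r \<in> Lp M p" by (intro Lp_diff p f step_Lp)
  have "step (coord ?r) = step (\<lambda>i. coord f i - c i)"
    by (rule step_cong) (simp add: coord_diff[OF f step_Lp] coord_step)
  then have eq: "step (coord f) \<omega> - f \<omega> = step (coord ?r) \<omega> - ?r \<omega>" for \<omega>
    by (simp add: step_diff)
  have "Lp_norm M p (\<lambda>\<omega>. step (coord f) \<omega> - f \<omega>) \<le> Lp_norm M p (step (coord ?r)) + Lp_norm M p ?r"
    unfolding eq by (intro Lp_norm_triangle p LpD(2) step_Lp r AE_I2 norm_triangle_ineq4)
  then show ?thesis using Lp_norm_step_coord_le[OF r] by simp
qed

end

section \<open>Approximation by step functions on a common partition\<close>

lemma Lp_simple_approx:
  assumes p: "1 < p" and f: "f \<in> Lp M p" and e: "0 < e"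
  shows "\<exists>s. simple_function M s \<and> s \<in> Lp M p \<and> Lp_norm M p (\<lambda>\<omega>. f \<omega> - s \<omega>) < e"
proof -
  note [measurable] = LpD(1)[OF f]
  obtain s where s: "\<And>i. simple_function M (s i)"
    "\<And>\<omega>. \<omega> \<in> space M \<Longrightarrow> (\<lambda>i. s i \<omega>) \<longlonglongrightarrow> f \<omega>"
    "\<And>i \<omega>. \<omega> \<in> space M \<Longrightarrow> norm (s i \<omega>) \<le> 2 * norm (f \<omega>)"
    using borel_measurable_implies_sequence_metric[OF LpD(1)[OF f], of 0]
    unfolding dist_0_norm dist_norm diff_0_right by metis
  have [measurable]: "s i \<in> borel_measurable M" for i
    using s(1) by (rule borel_measurable_simple_function)
  have s_Lp: "s i \<in> Lp M p" for i
  proof (rule Lp_dominated)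
    show "(\<lambda>\<omega>. 2 * f \<omega>) \<in> Lp M p" by (rule Lp_cmult[OF f])
  qed (use p s(3) in \<open>auto simp: norm_mult\<close>)
  have "(\<lambda>i. \<integral>\<omega>. norm (f \<omega> - s i \<omega>) powr p \<partial>M) \<longlonglongrightarrow> (\<integral>\<omega>. 0 \<partial>M)"
  proof (rule integral_dominated_convergence)
    \<comment> \<open>The approximants are bounded by twice the modulus of \<open>f\<close>, so the
      differences are bounded by three times it.\<close>
    show "integrable M (\<lambda>\<omega>. norm (3 * f \<omega>) powr p)"
      by (intro LpD(2) Lp_cmult f)
    show "AE \<omega> in M. (\<lambda>i. norm (f \<omega> - s i \<omega>) powr p) \<longlonglongrightarrow> 0"
    proof (rule AE_I2)
      fix \<omega> assume "\<omega> \<in> space M"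
      from s(2)[OF this] have "(\<lambda>i. norm (f \<omega> - s i \<omega>)) \<longlonglongrightarrow> norm (f \<omega> - f \<omega>)"
        by (intro tendsto_intros)
      then show "(\<lambda>i. norm (f \<omega> - s i \<omega>) powr p) \<longlonglongrightarrow> 0"
        using p tendsto_powr'[of "\<lambda>i. norm (f \<omega> - s i \<omega>)" 0 sequentially "\<lambda>_. p" p] by simp
    qed
    show "AE \<omega> in M. norm (norm (f \<omega> - s i \<omega>) powr p) \<le> norm (3 * f \<omega>) powr p" for i
    proof (rule AE_I2)
      fix \<omega> assume "\<omega> \<in> space M"
      from s(3)[OF this, of i] have "norm (f \<omega> - s i \<omega>) \<le> norm (3 * f \<omega>)"
        using norm_triangle_ineq4[of "f \<omega>" "s i \<omega>"] by (simp add: norm_mult)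
      then show "norm (norm (f \<omega> - s i \<omega>) powr p) \<le> norm (3 * f \<omega>) powr p"
        using p by (auto intro: powr_mono2)
    qed
  qed auto
  then have "\<forall>\<^sub>F i in sequentially. (\<integral>\<omega>. norm (f \<omega> - s i \<omega>) powr p \<partial>M) < (e / 2) powr p"
    using e by (intro order_tendstoD(2)) auto
  then obtain i where "(\<integral>\<omega>. norm (f \<omega> - s i \<omega>) powr p \<partial>M) < (e / 2) powr p"
    by (auto simp: eventually_sequentially)
  then have "Lp_norm M p (\<lambda>\<omega>. f \<omega> - s i \<omega>) \<le> e / 2"
    using p e by (subst Lp_norm_le_iff) auto
  with e s(1) s_Lp show ?thesis by (intro exI[of _ "s i"]) auto
qed

lemma simple_Lp_finite_emeasure:
  assumes "1 < p" "s \<in> Lp M p" "B \<in> sets M" "c \<noteq> 0" "\<And>\<omega>. \<omega> \<in> B \<Longrightarrow> s \<omega> = c"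
  shows "emeasure M B \<noteq> \<infinity>"
proof -
  have "integrable M (\<lambda>\<omega>. indicator B \<omega> * norm c powr p)"
    using assms by (intro Bochner_Integration.integrable_bound[OF LpD(2)[OF assms(2)]])
      (auto simp: indicator_def)
  then have "integrable M (\<lambda>\<omega>. (indicator B \<omega> * norm c powr p) / norm c powr p)"
    by (rule integrable_divide_zero)
  then show ?thesis
    using assms(3,4) by (simp add: integrable_indicator_iff Int_absorb2 sets.sets_into_space top.not_eq_extremum)
qed

text \<open>The atoms are the joint level sets of simple approximants of all the functions. Where
  all approximants vanish the measure may be infinite, but there the zero value of a step function
  is already correct.\<close>

lemma exists_common_finite_partition:
  assumes p: "1 < p" and K: "finite K" and f: "\<And>k. k \<in> K \<Longrightarrow> f k \<in> Lp M p" and e: "0 < e"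
  shows "\<exists>n A. finite_partition M p n A \<and>
    (\<forall>k\<in>K. \<exists>c. Lp_norm M p (\<lambda>\<omega>. f k \<omega> - finite_partition.step M p n A c \<omega>) < e)"
proof -
  have "\<exists>s. \<forall>k\<in>K. simple_function M (s k) \<and> s k \<in> Lp M p \<and> Lp_norm M p (\<lambda>\<omega>. f k \<omega> - s k \<omega>) < e"
    using Lp_simple_approx[OF p f e] by (intro bchoice) blast
  then obtain s where s: "\<And>k. k \<in> K \<Longrightarrow> simple_function M (s k)" "\<And>k. k \<in> K \<Longrightarrow> s k \<in> Lp M p"
    "\<And>k. k \<in> K \<Longrightarrow> Lp_norm M p (\<lambda>\<omega>. f k \<omega> - s k \<omega>) < e"
    by blast
  \<comment> \<open>Restriction to \<open>K\<close> makes the vectors extensional, so that they lie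
    in a finite product set.\<close>
  define V where "V = (\<lambda>\<omega>. \<lambda>k\<in>K. s k \<omega>)"
  define B where "B = (\<lambda>v. V -` {v} \<inter> space M)"
  have "V ` space M \<subseteq> PiE K (\<lambda>k. s k ` space M)"
    by (auto simp: V_def)
  moreover have "finite (PiE K (\<lambda>k. s k ` space M))"
    using K s(1) by (intro finite_PiE) (auto simp: simple_function_def)
  ultimately have fin: "finite (V ` space M)"
    by (rule finite_subset)
  have B_eq: "B v = {\<omega> \<in> space M. \<forall>k\<in>K. s k \<omega> = v k}" if "v \<in> V ` space M" for v
    using that by (auto simp: B_def V_def fun_eq_iff restrict_def split: if_splits)
  have B_sets: "B v \<in> sets M" if "v \<in> V ` space M" for v
    unfolding B_eq[OF that] using K s(1)[THEN borel_measurable_simple_function] by measurable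
  have B_finite: "emeasure M (B v) \<noteq> \<infinity>" if v: "v \<in> V ` space M" "k \<in> K" "v k \<noteq> 0" for v k
    using simple_Lp_finite_emeasure[OF p s(2)[OF v(2)] B_sets[OF v(1)] v(3)] v(2)
    by (auto simp: B_eq[OF v(1)])
  \<comment> \<open>A nonzero value of some approximant forces finite measure; the atoms of measure
    0 are dropped because \<open>coord\<close> and \<open>step\<close> divide by powers of the
    measure.\<close>
  define J where "J = {v \<in> V ` space M. (\<exists>k\<in>K. v k \<noteq> 0) \<and> 0 < measure M (B v)}"
  have "finite J" using fin by (simp add: J_def)
  then obtain h where h: "bij_betw h {..<card J} J"
    using ex_bij_betw_nat_finite[of J] by (auto simp: lessThan_atLeast0)
  have hJ: "h i \<in> J" if "i < card J" for i
    using h that by (auto dest: bij_betwE)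
  define A where "A = (\<lambda>i. B (h i))"
  interpret finite_partition M p "card J" A
  proof
    show "A i \<inter> A j = {}" if "i < card J" "j < card J" "i \<noteq> j" for i j
    proof -
      have "h i \<noteq> h j" using h that by (auto simp: bij_betw_def inj_on_def)
      then show ?thesis by (auto simp: A_def B_def)
    qed
    show "A i \<in> sets M" "emeasure M (A i) \<noteq> \<infinity>" "0 < measure M (A i)" if "i < card J" for i
    proof -
      from hJ[OF that] obtain k where "h i \<in> V ` space M" "k \<in> K" "h i k \<noteq> 0" "0 < measure M (B (h i))"
        by (auto simp: J_def)
      then show "A i \<in> sets M" "emeasure M (A i) \<noteq> \<infinity>" "0 < measure M (A i)"
        using B_sets B_finite by (simp_all only: A_def)
    qed
  qed (rule p)
  have null: "AE \<omega> in M. V \<omega> \<in> J \<or> (\<forall>k\<in>K. V \<omega> k = 0)"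
  proof -
    have "AE \<omega> in M. \<forall>v\<in>V ` space M. v \<notin> J \<longrightarrow> (\<exists>k\<in>K. v k \<noteq> 0) \<longrightarrow> \<omega> \<notin> B v"
    proof (rule AE_finite_allI[OF fin])
      fix v assume v: "v \<in> V ` space M"
      show "AE \<omega> in M. v \<notin> J \<longrightarrow> (\<exists>k\<in>K. v k \<noteq> 0) \<longrightarrow> \<omega> \<notin> B v"
      proof (cases "v \<notin> J \<and> (\<exists>k\<in>K. v k \<noteq> 0)")
        case True
        then have "measure M (B v) = 0" "emeasure M (B v) \<noteq> \<infinity>"
          using v B_finite[OF v] by (auto simp: J_def zero_less_measure_iff)
        then have "B v \<in> null_sets M"
          using B_sets[OF v] by (auto simp: null_sets_def emeasure_eq_ennreal_measure)
        from AE_not_in[OF this] show ?thesis by eventually_elim auto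
      qed auto
    qed
    with AE_space show ?thesis
      by eventually_elim (auto simp: B_def)
  qed
  have "\<exists>c. Lp_norm M p (\<lambda>\<omega>. f k \<omega> - step c \<omega>) < e" if k: "k \<in> K" for k
  proof -
    \<comment> \<open>The factor undoes the normalization built into \<open>step\<close>.\<close>
    define c where "c = (\<lambda>i. h i k * of_real (measure M (A i) powr (1 / p)))"
    have "AE \<omega> in M. s k \<omega> = step c \<omega>"
      using null AE_space
    proof eventually_elim
      case (elim \<omega>)
      have Vk: "V \<omega> k = s k \<omega>" using k by (simp add: V_def)
      show ?case
      proof (cases "V \<omega> \<in> J")
        case True
        then obtain i where i: "i < card J" "h i = V \<omega>"
          using h by (metis bij_betw_iff_bijections lessThan_iff)
        then have "\<omega> \<in> A i" using elim by (simp add: A_def B_def)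
        have "measure M (A i) powr (1 / p) * measure M (A i) powr (- 1 / p) = 1"
          unfolding powr_add[symmetric] using pos[OF i(1)] by simp
        then show ?thesis
          unfolding step_on[OF i(1) \<open>\<omega> \<in> A i\<close>] c_def mult.assoc of_real_mult[symmetric]
          using i Vk by simp
      next
        case False
        then have "\<omega> \<notin> A i" if "i < card J" for i
          using hJ[OF that] by (auto simp: A_def B_def)
        then show ?thesis using False elim k Vk step_off[of \<omega> c] by auto
      qed
    qed
    then have "Lp_norm M p (\<lambda>\<omega>. f k \<omega> - step c \<omega>) = Lp_norm M p (\<lambda>\<omega>. f k \<omega> - s k \<omega>)"
      using p k by (intro Lp_norm_cong_AE Lp_diff f step_Lp s(2)) auto
    with s(3)[OF k] show ?thesis by metis
  qed
  then show ?thesis using finite_partition_axioms by blast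
qed

section \<open>Contractively regular operators\<close>

text \<open>Regularity appears with constant 1 itself instead of an infimum of bounds. Boundedness
  is contained in \<open>T_regular\<close> as the case of a single function.\<close>

locale contractively_regular_operator =
  fixes M :: "'a measure" and p :: real and T :: "('a \<Rightarrow> complex) \<Rightarrow> 'a \<Rightarrow> complex"
  assumes p: "1 < p"
    and T_Lp: "\<And>f. f \<in> Lp M p \<Longrightarrow> T f \<in> Lp M p"
    and T_cong: "\<And>f g. f \<in> Lp M p \<Longrightarrow> g \<in> Lp M p \<Longrightarrow> AE \<omega> in M. f \<omega> = g \<omega> \<Longrightarrow>
          AE \<omega> in M. T f \<omega> = T g \<omega>"
    and T_add: "\<And>f g. f \<in> Lp M p \<Longrightarrow> g \<in> Lp M p \<Longrightarrow>
          AE \<omega> in M. T (\<lambda>\<omega>. f \<omega> + g \<omega>) \<omega> = T f \<omega> + T g \<omega>"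
    and T_cmult: "\<And>c f. f \<in> Lp M p \<Longrightarrow> AE \<omega> in M. T (\<lambda>\<omega>. c * f \<omega>) \<omega> = c * T f \<omega>"
    and T_regular: "\<And>n x. (\<And>k. k \<le> n \<Longrightarrow> x k \<in> Lp M p) \<Longrightarrow>
          Lp_norm M p (\<lambda>\<omega>. MAX k\<in>{..n::nat}. norm (T (x k) \<omega>))
            \<le> Lp_norm M p (\<lambda>\<omega>. MAX k\<in>{..n}. norm (x k \<omega>))"
begin

lemma p_pos: "0 < p"
  using p by simp

lemma contraction: "f \<in> Lp M p \<Longrightarrow> Lp_norm M p (T f) \<le> Lp_norm M p f"
  using T_regular[of 0 "\<lambda>_. f"] by (simp add: Lp_norm_norm)

lemma T_diff:
  assumes f: "f \<in> Lp M p" and g: "g \<in> Lp M p"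
  shows "AE \<omega> in M. T (\<lambda>\<omega>. f \<omega> - g \<omega>) \<omega> = T f \<omega> - T g \<omega>"
  using T_add[OF f Lp_cmult[OF g, of "-1"]] T_cmult[OF g, of "-1"]
  by eventually_elim simp

lemma T_zero: "AE \<omega> in M. T (\<lambda>_. 0) \<omega> = 0"
  using T_cmult[OF Lp_zero, of 0] by simp

lemma T_sum:
  "(\<And>i. i \<in> I \<Longrightarrow> f i \<in> Lp M p) \<Longrightarrow> AE \<omega> in M. T (\<lambda>\<omega>. \<Sum>i\<in>I. f i \<omega>) \<omega> = (\<Sum>i\<in>I. T (f i) \<omega>)"
proof (induction I rule: infinite_finite_induct)
  case (insert i I)
  then have "AE \<omega> in M. T (\<lambda>\<omega>. f i \<omega> + (\<Sum>i\<in>I. f i \<omega>)) \<omega> = T (f i) \<omega> + T (\<lambda>\<omega>. \<Sum>i\<in>I. f i \<omega>) \<omega>"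
    by (intro T_add Lp_sum p) auto
  moreover have "AE \<omega> in M. T (\<lambda>\<omega>. \<Sum>i\<in>I. f i \<omega>) \<omega> = (\<Sum>i\<in>I. T (f i) \<omega>)"
    using insert by auto
  ultimately have "AE \<omega> in M. T (\<lambda>\<omega>. f i \<omega> + (\<Sum>i\<in>I. f i \<omega>)) \<omega> = T (f i) \<omega> + (\<Sum>i\<in>I. T (f i) \<omega>)"
    by eventually_elim simp
  then show ?case using insert by simp
qed (simp_all add: T_zero)

lemma contraction_diff:
  assumes f: "f \<in> Lp M p" and g: "g \<in> Lp M p"
  shows "Lp_norm M p (\<lambda>\<omega>. T f \<omega> - T g \<omega>) \<le> Lp_norm M p (\<lambda>\<omega>. f \<omega> - g \<omega>)"
proof -
  have "Lp_norm M p (\<lambda>\<omega>. T f \<omega> - T g \<omega>) = Lp_norm M p (T (\<lambda>\<omega>. f \<omega> - g \<omega>))"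
    using T_diff[OF f g] by (intro Lp_norm_cong_AE p_pos Lp_diff p T_Lp f g) auto
  also have "\<dots> \<le> Lp_norm M p (\<lambda>\<omega>. f \<omega> - g \<omega>)"
    by (intro contraction Lp_diff p f g)
  finally show ?thesis .
qed

lemma funpow_Lp: "f \<in> Lp M p \<Longrightarrow> (T ^^ k) f \<in> Lp M p"
  by (induction k) (auto intro: T_Lp)

lemma ergodic_average_Lp: "f \<in> Lp M p \<Longrightarrow> ergodic_average T n f \<in> Lp M p"
  unfolding ergodic_average_def by (intro Lp_cmult Lp_sum p funpow_Lp)

subsection \<open>The matrix of a discretized operator\<close>

context
  fixes n :: nat and A :: "nat \<Rightarrow> 'a set"
  assumes partition: "finite_partition M p n A"
begin

interpretation finite_partition M p n A
  by (rule partition)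

text \<open>The compression of \<open>T\<close> to the step functions, in normalized
  coordinates.\<close>

definition matrix :: "nat \<Rightarrow> nat \<Rightarrow> complex" where
  "matrix i j = coord (T (step (\<lambda>k. if k = j then 1 else 0))) i"

text \<open>\<open>T\<close> is linear only up to null sets; for a finite combination these are
  finitely many, and the integrals in \<open>coord\<close> do not see them.\<close>

lemma coord_T_step:
  assumes i: "i < n"
  shows "coord (T (step c)) i = mat_op {..<n} matrix c i"
proof -
  let ?e = "\<lambda>j k. if k = j then 1 else (0 :: complex)"
  have step_eq: "step c = (\<lambda>\<omega>. \<Sum>j<n. c j * step (?e j) \<omega>)"
  proof
    fix \<omega>
    have "(\<Sum>j<n. c j * step (?e j) \<omega>) = step (\<lambda>k. \<Sum>j<n. c j * ?e j k) \<omega>"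
      by (simp only: step_sum step_mult)
    also have "\<dots> = step c \<omega>"
      by (intro fun_cong[OF step_cong]) (simp add: if_distrib cong: if_cong)
    finally show "step c \<omega> = (\<Sum>j<n. c j * step (?e j) \<omega>)" by simp
  qed
  have "AE \<omega> in M. T (\<lambda>\<omega>. \<Sum>j<n. c j * step (?e j) \<omega>) \<omega> = (\<Sum>j<n. T (\<lambda>\<omega>. c j * step (?e j) \<omega>) \<omega>)"
    by (intro T_sum Lp_cmult step_Lp)
  moreover have "AE \<omega> in M. \<forall>j\<in>{..<n}. T (\<lambda>\<omega>. c j * step (?e j) \<omega>) \<omega> = c j * T (step (?e j)) \<omega>"
    by (intro AE_finite_allI T_cmult step_Lp) auto
  ultimately have "AE \<omega> in M. T (step c) \<omega> = (\<Sum>j<n. c j * T (step (?e j)) \<omega>)"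
    unfolding step_eq[symmetric] by eventually_elim simp
  then have "coord (T (step c)) i = coord (\<lambda>\<omega>. \<Sum>j<n. c j * T (step (?e j)) \<omega>) i"
    using i by (intro coord_cong_AE LpD(1)[of _ M p] Lp_sum Lp_cmult T_Lp step_Lp p)
  also have "\<dots> = mat_op {..<n} matrix c i"
    using i by (simp add: coord_sum Lp_cmult T_Lp step_Lp coord_cmult mat_op_def matrix_def mult.commute)
  finally show ?thesis .
qed

(* Row i of the modulus is attained at the vector f rotated by the conjugate signs of row i;
   regularity treats all rows simultaneously. *)
lemma modulus_contraction:
  assumes f: "\<And>i. 0 \<le> f i"
  shows "(\<Sum>i<n. mat_op {..<n} (\<lambda>i j. norm (matrix i j)) f i powr p) \<le> (\<Sum>i<n. f i powr p)"
proof (cases n)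
  case (Suc m)
  then have I: "{..<n} = {..m}" by auto
  define x where "x = (\<lambda>k. step (\<lambda>j. cnj (sgn (matrix k j)) * of_real (f j)))"
  have x: "x k \<in> Lp M p" for k by (simp add: x_def step_Lp)
  let ?F = "\<lambda>\<omega>. MAX k\<in>{..m}. norm (T (x k) \<omega>)"
  have F: "(\<lambda>\<omega>. complex_of_real (?F \<omega>)) \<in> Lp M p"
    by (intro Lp_Max p T_Lp x) auto
  have "mat_op {..<n} (\<lambda>i j. norm (matrix i j)) f i
      \<le> norm (coord (\<lambda>\<omega>. complex_of_real (?F \<omega>)) i)" if i: "i < n" for i
  proof -
    have "matrix i j * (cnj (sgn (matrix i j)) * of_real (f j)) = of_real (norm (matrix i j) * f j)" for j
    proof -
      have "z * cnj (sgn z) = of_real (norm z)" for z :: complex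
        using complex_norm_square[of z] by (cases "z = 0") (simp_all add: sgn_eq power2_eq_square field_simps)
      then show ?thesis by (simp flip: mult.assoc)
    qed
    then have "coord (T (x i)) i = of_real (mat_op {..<n} (\<lambda>i j. norm (matrix i j)) f i)"
      unfolding x_def coord_T_step[OF i] mat_op_def of_real_sum by (intro sum.cong) auto
    moreover have "norm (coord (T (x i)) i) \<le> norm (coord (\<lambda>\<omega>. complex_of_real (?F \<omega>)) i)"
      using i Suc by (intro coord_mono T_Lp x F AE_I2) auto
    ultimately show ?thesis by (simp add: abs_le_iff)
  qed
  then have "(\<Sum>i<n. mat_op {..<n} (\<lambda>i j. norm (matrix i j)) f i powr p)
      \<le> (\<Sum>i<n. norm (coord (\<lambda>\<omega>. complex_of_real (?F \<omega>)) i) powr p)"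
    using p_pos f by (intro sum_mono powr_mono2 mat_op_nonneg) auto
  also have "\<dots> \<le> Lp_norm M p (\<lambda>\<omega>. complex_of_real (?F \<omega>)) powr p"
    by (rule sum_coord_powr_le[OF F])
  also have "\<dots> = Lp_norm M p ?F powr p"
    by (simp add: Lp_norm_def)
  also have "\<dots> \<le> Lp_norm M p (step (\<lambda>j. of_real (f j))) powr p"
  proof (intro powr_mono2 order_trans[OF T_regular[of m x]] Lp_norm_mono)
    \<comment> \<open>The rotating factors have modulus at most 1 (\<open>sgn 0 = 0\<close>), so a
      single step function, independent of the row, dominates all the \<open>x k\<close>.\<close>
    have "norm (x k \<omega>) \<le> norm (step (\<lambda>j. of_real (f j)) \<omega>)" for k \<omega>
      unfolding x_def by (intro step_mono) (auto simp: norm_mult norm_sgn)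
    moreover from this have "0 \<le> (MAX k\<in>{..m}. norm (x k \<omega>))" for \<omega>
      by (intro order_trans[OF _ Max_ge[of _ "norm (x 0 \<omega>)"]]) auto
    ultimately show "AE \<omega> in M. norm (MAX k\<in>{..m}. norm (x k \<omega>)) \<le> norm (step (\<lambda>j. of_real (f j)) \<omega>)"
      by (intro AE_I2) (simp del: Max_ge_iff)
  qed (use p_pos x LpD(2)[OF step_Lp] in \<open>auto simp: Lp_norm_nonneg\<close>)
  also have "\<dots> = (\<Sum>i<n. f i powr p)"
    using f by (simp add: Lp_norm_step)
  finally show ?thesis .
qed simp

text \<open>Powers of the matrix are dominated entrywise by powers of its modulus, to which the
  inequality for nonnegative matrices applies. All functions here are step functions, so the
  domination holds at every point.\<close>

lemma maximal_inequality_matrix: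
  assumes f: "f \<in> Lp M p"
  shows "\<exists>g\<in>Lp M p. Lp_norm M p g \<le> p / (p - 1) * Lp_norm M p f \<and>
    (\<forall>m\<le>N. \<forall>\<omega>. norm ((\<Sum>k\<le>m. step ((mat_op {..<n} matrix ^^ k) (coord f)) \<omega>) / of_nat (m + 1))
      \<le> norm (g \<omega>))"
proof -
  interpret positive_matrix_contraction "{..<n}" "\<lambda>i j. norm (matrix i j)" p "p / (p - 1)"
    by unfold_locales (use p modulus_contraction in auto)
  let ?B = "mat_op {..<n} matrix"
  define avg where "avg = (\<lambda>m i. (\<Sum>k\<le>m. (mat_op {..<n} (\<lambda>i j. norm (matrix i j)) ^^ k)
      (\<lambda>i. norm (coord f i)) i) / real (m + 1))"
  have avg_nonneg: "0 \<le> avg m i" for m i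
    unfolding avg_def by (intro divide_nonneg_nonneg sum_nonneg mat_op_funpow_nonneg) auto
  \<comment> \<open>\<open>\<nu> i\<close> is a time up to \<open>N\<close> at which the nonnegative
    average at coordinate \<open>i\<close> is largest.\<close>
  have "\<exists>\<nu>. \<forall>i. \<nu> i \<le> N \<and> (\<forall>m\<le>N. avg m i \<le> avg (\<nu> i) i)"
  proof (intro choice allI)
    fix i
    have "Max ((\<lambda>m. avg m i) ` {..N}) \<in> (\<lambda>m. avg m i) ` {..N}"
      by (intro Max_in) auto
    then obtain m where "m \<le> N" "avg m i = Max ((\<lambda>m. avg m i) ` {..N})"
      by (metis (no_types, lifting) atMost_iff imageE)
    then show "\<exists>m. m \<le> N \<and> (\<forall>k\<le>N. avg k i \<le> avg m i)"
      by (intro exI[of _ m]) auto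
  qed
  then obtain \<nu> where \<nu>: "\<And>i. \<nu> i \<le> N" "\<And>i m. m \<le> N \<Longrightarrow> avg m i \<le> avg (\<nu> i) i"
    by blast
  let ?g = "step (\<lambda>i. of_real (avg (\<nu> i) i))"
  show ?thesis
  proof (intro bexI conjI allI impI)
    show "?g \<in> Lp M p" by (rule step_Lp)
    have "Lp_norm M p ?g powr p = (\<Sum>i<n. avg (\<nu> i) i powr p)"
      using avg_nonneg by (simp add: Lp_norm_step)
    also have "\<dots> \<le> (p / (p - 1)) powr p * (\<Sum>i<n. norm (coord f i) powr p)"
      using maximal_inequality[of "\<lambda>i. norm (coord f i)" \<nu> N] \<nu>(1) by (simp add: avg_def)
    also have "\<dots> \<le> (p / (p - 1)) powr p * Lp_norm M p f powr p"
      by (intro mult_left_mono sum_coord_powr_le f) auto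
    also have "\<dots> = (p / (p - 1) * Lp_norm M p f) powr p"
      using p by (subst powr_mult) (auto simp: Lp_norm_nonneg)
    finally show "Lp_norm M p ?g \<le> p / (p - 1) * Lp_norm M p f"
      using p by (subst Lp_norm_le_iff) (auto simp: Lp_norm_nonneg Lp_norm_powr)
    fix m \<omega> assume "m \<le> N"
    have "(\<Sum>k\<le>m. step ((?B ^^ k) (coord f)) \<omega>) / of_nat (m + 1)
        = step (\<lambda>i. 1 / of_nat (m + 1) * (\<Sum>k\<le>m. (?B ^^ k) (coord f) i)) \<omega>"
      by (simp only: step_mult step_sum) simp
    also have "norm \<dots> \<le> norm (?g \<omega>)"
    proof (rule step_mono)
      fix i
      have "norm (1 / of_nat (m + 1) * (\<Sum>k\<le>m. (?B ^^ k) (coord f) i))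
          = norm (\<Sum>k\<le>m. (?B ^^ k) (coord f) i) / real (m + 1)"
        by (simp only: norm_mult norm_divide norm_of_nat norm_one) simp
      also have "\<dots> \<le> avg m i"
        unfolding avg_def
        by (intro divide_right_mono order_trans[OF norm_sum] sum_mono norm_mat_op_funpow_le) auto
      also have "\<dots> \<le> norm (complex_of_real (avg (\<nu> i) i))"
        using \<nu>(2)[OF \<open>m \<le> N\<close>, of i] by simp
      finally show "norm (1 / of_nat (m + 1) * (\<Sum>k\<le>m. (?B ^^ k) (coord f) i))
          \<le> norm (complex_of_real (avg (\<nu> i) i))" .
    qed
    finally show "norm ((\<Sum>k\<le>m. step ((?B ^^ k) (coord f)) \<omega>) / of_nat (m + 1)) \<le> norm (?g \<omega>)" .
  qed
qed

text \<open>Each iteration adds one averaging error \<open>\<delta>\<close>. Earlier errors are not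
  amplified, since \<open>T\<close> and averaging over the partition are contractions.\<close>

lemma discretized_orbit_close:
  assumes f: "f \<in> Lp M p"
    and close: "\<And>k. k \<le> N \<Longrightarrow> Lp_norm M p (\<lambda>\<omega>. step (coord ((T ^^ k) f)) \<omega> - (T ^^ k) f \<omega>) \<le> \<delta>"
    and "k \<le> N"
  shows "Lp_norm M p (\<lambda>\<omega>. step ((mat_op {..<n} matrix ^^ k) (coord f)) \<omega> - (T ^^ k) f \<omega>)
    \<le> real (k + 1) * \<delta>"
  using \<open>k \<le> N\<close>
proof (induction k)
  case 0
  then show ?case using close[of 0] by simp
next
  case (Suc k)
  let ?v = "step ((mat_op {..<n} matrix ^^ k) (coord f))" and ?y = "(T ^^ k) f"
  note y = funpow_Lp[OF f, of k]
  have v_Suc: "step ((mat_op {..<n} matrix ^^ Suc k) (coord f)) = step (coord (T ?v))"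
    by (rule step_cong) (simp add: coord_T_step)
  have "Lp_norm M p (\<lambda>\<omega>. step (coord (T ?v)) \<omega> - (T ^^ Suc k) f \<omega>)
      \<le> Lp_norm M p (\<lambda>\<omega>. step (coord (T ?v)) \<omega> - step (coord (T ?y)) \<omega>)
        + Lp_norm M p (\<lambda>\<omega>. step (coord (T ?y)) \<omega> - (T ^^ Suc k) f \<omega>)"
    by (intro Lp_norm_triangle_diff p step_Lp funpow_Lp f)
  also have "Lp_norm M p (\<lambda>\<omega>. step (coord (T ?v)) \<omega> - step (coord (T ?y)) \<omega>)
      = Lp_norm M p (step (coord (\<lambda>\<omega>. T ?v \<omega> - T ?y \<omega>)))"
    unfolding step_diff[symmetric]
    by (intro arg_cong[where f = "Lp_norm M p"] step_cong) (simp add: coord_diff T_Lp step_Lp y)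
  also have "\<dots> \<le> Lp_norm M p (\<lambda>\<omega>. T ?v \<omega> - T ?y \<omega>)"
    by (intro Lp_norm_step_coord_le Lp_diff p T_Lp step_Lp y)
  also have "\<dots> \<le> Lp_norm M p (\<lambda>\<omega>. ?v \<omega> - ?y \<omega>)"
    by (intro contraction_diff step_Lp y)
  also have "\<dots> \<le> real (k + 1) * \<delta>"
    using Suc by simp
  finally show ?case
    unfolding v_Suc using close[of "Suc k"] Suc.prems by (simp add: algebra_simps)
qed

end

subsection \<open>The maximal ergodic inequality\<close>

lemma maximal_inequality_finite:
  assumes f: "f \<in> Lp M p"
  shows "Lp_norm M p (\<lambda>\<omega>. MAX m\<in>{..N}. norm (ergodic_average T m f \<omega>)) \<le> p / (p - 1) * Lp_norm M p f"
proof (rule field_le_epsilon)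
  fix e :: real assume e: "0 < e"
  \<comment> \<open>There are \<open>N + 1\<close> orbit errors, each at most
    \<open>(N + 1) * \<delta>\<close>; they add up to \<open>e\<close>.\<close>
  define \<delta> where "\<delta> = e / (real (N + 1) * real (N + 1))"
  have \<delta>: "0 < \<delta>" using e by (simp add: \<delta>_def)
  \<comment> \<open>Accuracy \<open>\<delta> / 2\<close> is requested because averaging over the
    partition may double the error.\<close>
  obtain n A where part: "finite_partition M p n A"
    and approx: "\<And>k. k \<le> N \<Longrightarrow>
      \<exists>c. Lp_norm M p (\<lambda>\<omega>. (T ^^ k) f \<omega> - finite_partition.step M p n A c \<omega>) < \<delta> / 2"
    using exists_common_finite_partition[OF p, of "{..N}" "\<lambda>k. (T ^^ k) f" M "\<delta> / 2"] \<delta> funpow_Lp[OF f]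
    by auto
  interpret finite_partition M p n A by (rule part)
  have "Lp_norm M p (\<lambda>\<omega>. step (coord ((T ^^ k) f)) \<omega> - (T ^^ k) f \<omega>) \<le> \<delta>" if k: "k \<le> N" for k
  proof -
    obtain c where "Lp_norm M p (\<lambda>\<omega>. (T ^^ k) f \<omega> - step c \<omega>) < \<delta> / 2"
      using approx[OF k] by blast
    then show ?thesis
      using Lp_norm_step_coord_diff_le[OF funpow_Lp[OF f, of k], of c] by simp
  qed
  note close = discretized_orbit_close[OF part f this]
  obtain g where g: "g \<in> Lp M p" "Lp_norm M p g \<le> p / (p - 1) * Lp_norm M p f"
    "\<And>m \<omega>. m \<le> N \<Longrightarrow>
      norm ((\<Sum>k\<le>m. step ((mat_op {..<n} (matrix n A) ^^ k) (coord f)) \<omega>) / of_nat (m + 1)) \<le> norm (g \<omega>)"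
    using maximal_inequality_matrix[OF part f, of N] by blast
  define v where "v = (\<lambda>k. step ((mat_op {..<n} (matrix n A) ^^ k) (coord f)))"
  let ?d = "\<lambda>k \<omega>. v k \<omega> - (T ^^ k) f \<omega>"
  have d: "?d k \<in> Lp M p" for k
    unfolding v_def by (intro Lp_diff p step_Lp funpow_Lp f)
  let ?D = "\<lambda>\<omega>. \<Sum>k\<le>N. complex_of_real (norm (?d k \<omega>))"
  have D: "?D \<in> Lp M p" by (intro Lp_sum p Lp_norm_fun d)
  have bound: "norm (ergodic_average T m f \<omega>) \<le> norm (g \<omega>) + norm (?D \<omega>)" if m: "m \<le> N" for m \<omega>
  proof -
    have "ergodic_average T m f \<omega> = (\<Sum>k\<le>m. v k \<omega>) / of_nat (m + 1) - (\<Sum>k\<le>m. ?d k \<omega>) / of_nat (m + 1)"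
      by (simp add: ergodic_average_def atLeast0AtMost sum_subtractf diff_divide_distrib)
    then have "norm (ergodic_average T m f \<omega>)
        \<le> norm ((\<Sum>k\<le>m. v k \<omega>) / of_nat (m + 1)) + norm ((\<Sum>k\<le>m. ?d k \<omega>) / of_nat (m + 1))"
      by (metis norm_triangle_ineq4)
    also have "norm ((\<Sum>k\<le>m. v k \<omega>) / of_nat (m + 1)) \<le> norm (g \<omega>)"
      unfolding v_def by (rule g(3)[OF m])
    also have "norm ((\<Sum>k\<le>m. ?d k \<omega>) / of_nat (m + 1)) \<le> norm (\<Sum>k\<le>m. ?d k \<omega>)"
      unfolding norm_divide norm_of_nat by (rule divide_left_mono[of 1, simplified]) auto
    also have "\<dots> \<le> (\<Sum>k\<le>N. norm (?d k \<omega>))"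
      using m by (intro order_trans[OF norm_sum] sum_mono2) auto
    also have "\<dots> = norm (?D \<omega>)"
      by (simp add: sum_nonneg flip: of_real_sum)
    finally show ?thesis by simp
  qed
  have "Lp_norm M p (\<lambda>\<omega>. MAX m\<in>{..N}. norm (ergodic_average T m f \<omega>)) \<le> Lp_norm M p g + Lp_norm M p ?D"
  proof (intro Lp_norm_triangle p LpD(2) g(1) D AE_I2)
    fix \<omega>
    have "0 \<le> (MAX m\<in>{..N}. norm (ergodic_average T m f \<omega>))"
      by (intro order_trans[OF _ Max_ge[of _ "norm (ergodic_average T 0 f \<omega>)"]]) auto
    then show "norm (MAX m\<in>{..N}. norm (ergodic_average T m f \<omega>)) \<le> norm (g \<omega>) + norm (?D \<omega>)"
      using bound by (simp del: Max_ge_iff)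
  qed
  also have "Lp_norm M p ?D \<le> (\<Sum>k\<le>N. Lp_norm M p (?d k))"
    by (rule Lp_norm_sum_le[OF p]) (auto simp: d sum_nonneg simp flip: of_real_sum)
  also have "\<dots> \<le> (\<Sum>k\<le>N. real (N + 1) * \<delta>)"
  proof (rule sum_mono)
    fix k assume k: "k \<in> {..N}"
    have "Lp_norm M p (?d k) \<le> real (k + 1) * \<delta>"
      unfolding v_def using k by (intro close) auto
    also have "\<dots> \<le> real (N + 1) * \<delta>"
      using k \<delta> by (intro mult_right_mono) auto
    finally show "Lp_norm M p (?d k) \<le> real (N + 1) * \<delta>" .
  qed
  also have "\<dots> = e"
    by (simp add: \<delta>_def)
  finally show "Lp_norm M p (\<lambda>\<omega>. MAX m\<in>{..N}. norm (ergodic_average T m f \<omega>))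
      \<le> p / (p - 1) * Lp_norm M p f + e"
    using g(2) by simp
qed

end

context contractively_regular_operator
begin

text \<open>Monotone convergence in the number of iterates, possible because the constant in the
  finite inequality does not depend on it.\<close>

lemma maximal_function:
  assumes f: "f \<in> Lp M p"
  shows "\<exists>F. integrable M (\<lambda>\<omega>. norm (F \<omega> :: real) powr p)
    \<and> Lp_norm M p F \<le> p / (p - 1) * Lp_norm M p f
    \<and> (AE \<omega> in M. \<forall>n. norm (ergodic_average T n f \<omega>) \<le> F \<omega>)"
proof -
  let ?a = "\<lambda>n \<omega>. norm (ergodic_average T n f \<omega>)"
  let ?K = "p / (p - 1) * Lp_norm M p f"
  define g where "g = (\<lambda>N \<omega>. MAX m\<in>{..N}. ?a m \<omega>)"
  have [measurable]: "g N \<in> borel_measurable M" for N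
    unfolding g_def using LpD(1)[OF ergodic_average_Lp[OF f]] by measurable
  have a_le_g: "?a m \<omega> \<le> g N \<omega>" if "m \<le> N" for m N \<omega>
    unfolding g_def using that by (intro Max_ge) auto
  have g_nonneg: "0 \<le> g N \<omega>" for N \<omega>
    by (rule order_trans[OF norm_ge_zero a_le_g[OF order_refl]])
  have g_mono: "g N \<omega> \<le> g N' \<omega>" if "N \<le> N'" for N N' \<omega>
    unfolding g_def using that by (intro Max_mono) auto
  have g_int: "integrable M (\<lambda>\<omega>. g N \<omega> powr p)" for N
    using LpD(2)[OF Lp_Max[of p "{..N}" "\<lambda>m. ergodic_average T m f" M]] p ergodic_average_Lp[OF f]
      g_nonneg[of N] by (simp add: g_def)
  have g_le: "(\<integral>\<omega>. g N \<omega> powr p \<partial>M) \<le> ?K powr p" for N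
    using maximal_inequality_finite[OF f, of N] p g_nonneg[of N]
    by (subst (asm) Lp_norm_le_iff) (auto simp: Lp_norm_nonneg g_def)
  define S where "S = (\<lambda>\<omega>. SUP N. ennreal (g N \<omega> powr p))"
  have [measurable]: "S \<in> borel_measurable M"
    unfolding S_def by measurable
  have "incseq (\<lambda>N \<omega>. ennreal (g N \<omega> powr p))"
    using p g_nonneg g_mono by (auto simp: incseq_def le_fun_def intro!: ennreal_leI powr_mono2)
  then have "(\<integral>\<^sup>+\<omega>. S \<omega> \<partial>M) = (SUP N. \<integral>\<^sup>+\<omega>. ennreal (g N \<omega> powr p) \<partial>M)"
    unfolding S_def by (intro nn_integral_monotone_convergence_SUP) auto
  also have "\<dots> \<le> ennreal (?K powr p)"
    using g_int g_le by (intro SUP_least) (simp add: nn_integral_eq_integral ennreal_leI)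
  finally have S_le: "(\<integral>\<^sup>+\<omega>. S \<omega> \<partial>M) \<le> ennreal (?K powr p)" .
  then have S_fin: "AE \<omega> in M. S \<omega> \<noteq> \<infinity>"
    by (intro nn_integral_PInf_AE) (auto simp: top_unique)
  \<comment> \<open>\<open>enn2real\<close> sends infinity to 0; this spoils the domination only on
    the null set where \<open>S\<close> is infinite.\<close>
  define F where "F = (\<lambda>\<omega>. enn2real (S \<omega>) powr (1 / p))"
  have F_powr: "norm (F \<omega>) powr p = enn2real (S \<omega>)" for \<omega>
    using p by (simp add: F_def powr_powr)
  have "(\<integral>\<^sup>+\<omega>. ennreal (norm (F \<omega>) powr p) \<partial>M) = (\<integral>\<^sup>+\<omega>. S \<omega> \<partial>M)"
    unfolding F_powr using S_fin
    by (intro nn_integral_cong_AE) (auto simp: top.not_eq_extremum elim: eventually_mono)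
  with S_le have le: "(\<integral>\<^sup>+\<omega>. ennreal (norm (F \<omega>) powr p) \<partial>M) \<le> ennreal (?K powr p)"
    by simp
  then have int: "integrable M (\<lambda>\<omega>. norm (F \<omega>) powr p)"
    unfolding F_powr by (intro integrableI_bounded) (auto intro: le_less_trans)
  moreover have "Lp_norm M p F \<le> ?K"
    using le int p by (subst Lp_norm_le_iff) (auto simp: nn_integral_eq_integral Lp_norm_nonneg)
  moreover have "AE \<omega> in M. \<forall>n. ?a n \<omega> \<le> F \<omega>"
    using S_fin
  proof eventually_elim
    case (elim \<omega>)
    show ?case
    proof
      fix n
      have "ennreal (?a n \<omega> powr p) \<le> ennreal (g n \<omega> powr p)"
        using p a_le_g[of n n \<omega>] by (intro ennreal_leI powr_mono2) auto
      also have "\<dots> \<le> S \<omega>"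
        unfolding S_def by (rule SUP_upper) simp
      finally have "?a n \<omega> powr p \<le> enn2real (S \<omega>)"
        using elim by (metis enn2real_ennreal enn2real_mono infinity_ennreal_def less_top powr_ge_zero)
      then have "(?a n \<omega> powr p) powr (1 / p) \<le> F \<omega>"
        unfolding F_def using p by (intro powr_mono2) auto
      then show "?a n \<omega> \<le> F \<omega>" using p by (simp add: powr_powr)
    qed
  qed
  ultimately show ?thesis by blast
qed

section \<open>Algebra of iterates and averages modulo null sets\<close>

lemma funpow_cong:
  assumes "f \<in> Lp M p" "g \<in> Lp M p" "AE \<omega> in M. f \<omega> = g \<omega>"
  shows "AE \<omega> in M. (T ^^ k) f \<omega> = (T ^^ k) g \<omega>"
proof (induction k)
  case (Suc k)
  then show ?case using T_cong[OF funpow_Lp funpow_Lp] assms by simp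
qed (use assms in simp)

lemma funpow_diff:
  assumes f: "f \<in> Lp M p" and g: "g \<in> Lp M p"
  shows "AE \<omega> in M. (T ^^ k) (\<lambda>\<omega>. f \<omega> - g \<omega>) \<omega> = (T ^^ k) f \<omega> - (T ^^ k) g \<omega>"
proof (induction k)
  case (Suc k)
  have "AE \<omega> in M. T ((T ^^ k) (\<lambda>\<omega>. f \<omega> - g \<omega>)) \<omega> = T (\<lambda>\<omega>. (T ^^ k) f \<omega> - (T ^^ k) g \<omega>) \<omega>"
    by (intro T_cong funpow_Lp Lp_diff p f g Suc)
  moreover have "AE \<omega> in M. T (\<lambda>\<omega>. (T ^^ k) f \<omega> - (T ^^ k) g \<omega>) \<omega> = T ((T ^^ k) f) \<omega> - T ((T ^^ k) g) \<omega>"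
    by (intro T_diff funpow_Lp f g)
  ultimately show ?case by eventually_elim simp
qed simp

lemma funpow_contraction: "f \<in> Lp M p \<Longrightarrow> Lp_norm M p ((T ^^ k) f) \<le> Lp_norm M p f"
  by (induction k) (auto intro: order_trans[OF contraction] funpow_Lp)

text \<open>The quantifier over \<open>n\<close> stands inside the almost everywhere statement, as
  countably many null sets are collected; the pointwise limits are taken with the point
  fixed.\<close>

lemma ergodic_average_cong:
  assumes "f \<in> Lp M p" "g \<in> Lp M p" "AE \<omega> in M. f \<omega> = g \<omega>"
  shows "AE \<omega> in M. \<forall>n. ergodic_average T n f \<omega> = ergodic_average T n g \<omega>"
proof -
  have "AE \<omega> in M. \<forall>k. (T ^^ k) f \<omega> = (T ^^ k) g \<omega>"
    unfolding AE_all_countable using funpow_cong[OF assms] by blast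
  then show ?thesis by eventually_elim (simp add: ergodic_average_def)
qed

lemma ergodic_average_diff:
  assumes "f \<in> Lp M p" "g \<in> Lp M p"
  shows "AE \<omega> in M. \<forall>n. ergodic_average T n (\<lambda>\<omega>. f \<omega> - g \<omega>) \<omega>
    = ergodic_average T n f \<omega> - ergodic_average T n g \<omega>"
proof -
  have "AE \<omega> in M. \<forall>k. (T ^^ k) (\<lambda>\<omega>. f \<omega> - g \<omega>) \<omega> = (T ^^ k) f \<omega> - (T ^^ k) g \<omega>"
    unfolding AE_all_countable using funpow_diff[OF assms] by blast
  then show ?thesis
    by eventually_elim (simp add: ergodic_average_def sum_subtractf right_diff_distrib diff_divide_distrib)
qed

lemma ergodic_average_fixed:
  assumes y: "y \<in> Lp M p" "AE \<omega> in M. y \<omega> = T y \<omega>"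
  shows "AE \<omega> in M. \<forall>n. ergodic_average T n y \<omega> = y \<omega>"
proof -
  have "AE \<omega> in M. (T ^^ k) y \<omega> = y \<omega>" for k
  proof (induction k)
    case (Suc k)
    have "AE \<omega> in M. T ((T ^^ k) y) \<omega> = T y \<omega>"
      by (intro T_cong funpow_Lp y Suc)
    with y(2) show ?case by eventually_elim simp
  qed simp
  then have "AE \<omega> in M. \<forall>k. (T ^^ k) y \<omega> = y \<omega>"
    unfolding AE_all_countable by blast
  then show ?thesis
    by eventually_elim (simp add: ergodic_average_def del: of_nat_add of_nat_Suc)
qed

lemma ergodic_average_coboundary:
  assumes u: "u \<in> Lp M p"
  shows "AE \<omega> in M. \<forall>n. ergodic_average T n (\<lambda>\<omega>. u \<omega> - T u \<omega>) \<omega>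
    = (u \<omega> - (T ^^ Suc n) u \<omega>) / of_nat (n + 1)"
proof -
  have "AE \<omega> in M. \<forall>k. (T ^^ k) (\<lambda>\<omega>. u \<omega> - T u \<omega>) \<omega> = (T ^^ k) u \<omega> - (T ^^ Suc k) u \<omega>"
    unfolding AE_all_countable funpow_Suc_right comp_def using funpow_diff[OF u T_Lp[OF u]] by blast
  then show ?thesis
  proof eventually_elim
    case (elim \<omega>)
    have "(\<Sum>k=0..n. (T ^^ k) u \<omega> - (T ^^ Suc k) u \<omega>) = u \<omega> - (T ^^ Suc n) u \<omega>" for n
      using sum_telescope[of "\<lambda>k. (T ^^ k) u \<omega>" n] by (simp add: atLeast0AtMost)
    then show ?case using elim by (simp add: ergodic_average_def del: funpow.simps)
  qed
qed

lemma ergodic_average_contraction: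
  assumes f: "f \<in> Lp M p"
  shows "Lp_norm M p (ergodic_average T n f) \<le> Lp_norm M p f"
proof -
  have "Lp_norm M p (\<lambda>\<omega>. \<Sum>k=0..n. (T ^^ k) f \<omega>) \<le> (\<Sum>k=0..n. Lp_norm M p ((T ^^ k) f))"
    by (intro Lp_norm_sum_le p funpow_Lp f AE_I2 norm_sum) auto
  also have "\<dots> \<le> (\<Sum>k=0..n. Lp_norm M p f)"
    by (intro sum_mono funpow_contraction f)
  finally have "Lp_norm M p (\<lambda>\<omega>. \<Sum>k=0..n. (T ^^ k) f \<omega>) \<le> real (n + 1) * Lp_norm M p f"
    by simp
  then show ?thesis
    unfolding ergodic_average_def Lp_norm_mult[OF p_pos] by (simp add: norm_divide field_simps del: of_nat_add of_nat_Suc)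
qed

text \<open>The range of \<open>I - T\<close>, saturated under almost everywhere equality so that
  identities up to null sets prove membership.\<close>

definition coboundary :: "('a \<Rightarrow> complex) \<Rightarrow> bool" where
  "coboundary z \<longleftrightarrow> z \<in> Lp M p \<and> (\<exists>u\<in>Lp M p. AE \<omega> in M. z \<omega> = u \<omega> - T u \<omega>)"

lemma coboundary_zero: "coboundary (\<lambda>_. 0)"
  unfolding coboundary_def using Lp_zero T_zero by (auto intro!: bexI[of _ "\<lambda>_. 0"])

lemma coboundary_add:
  assumes "coboundary z" "coboundary w"
  shows "coboundary (\<lambda>\<omega>. z \<omega> + w \<omega>)"
proof -
  from assms obtain u v where uv: "u \<in> Lp M p" "v \<in> Lp M p"
    and AE: "AE \<omega> in M. z \<omega> = u \<omega> - T u \<omega>" "AE \<omega> in M. w \<omega> = v \<omega> - T v \<omega>"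
    by (auto simp: coboundary_def)
  from T_add[OF uv] AE have "AE \<omega> in M. z \<omega> + w \<omega> = (u \<omega> + v \<omega>) - T (\<lambda>\<omega>. u \<omega> + v \<omega>) \<omega>"
    by eventually_elim simp
  with assms uv show ?thesis
    unfolding coboundary_def
    by (intro conjI bexI[of _ "\<lambda>\<omega>. u \<omega> + v \<omega>"] Lp_add p) (auto simp: coboundary_def)
qed

lemma coboundary_cmult:
  assumes "coboundary z"
  shows "coboundary (\<lambda>\<omega>. c * z \<omega>)"
proof -
  from assms obtain u where u: "u \<in> Lp M p" and AE: "AE \<omega> in M. z \<omega> = u \<omega> - T u \<omega>"
    by (auto simp: coboundary_def)
  from T_cmult[OF u, of c] AE have "AE \<omega> in M. c * z \<omega> = c * u \<omega> - T (\<lambda>\<omega>. c * u \<omega>) \<omega>"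
    by eventually_elim (simp add: right_diff_distrib)
  with assms u show ?thesis
    unfolding coboundary_def
    by (intro conjI bexI[of _ "\<lambda>\<omega>. c * u \<omega>"] Lp_cmult) (auto simp: coboundary_def)
qed

lemma coboundary_sum:
  "(\<And>i. i \<in> I \<Longrightarrow> coboundary (z i)) \<Longrightarrow> coboundary (\<lambda>\<omega>. \<Sum>i\<in>I. z i \<omega>)"
  by (induction I rule: infinite_finite_induct) (auto intro: coboundary_zero coboundary_add)

lemma coboundary_orbit:
  assumes x: "x \<in> Lp M p"
  shows "coboundary (\<lambda>\<omega>. x \<omega> - (T ^^ k) x \<omega>)"
proof (induction k)
  case (Suc k)
  have "coboundary (\<lambda>\<omega>. (T ^^ k) x \<omega> - T ((T ^^ k) x) \<omega>)"
    unfolding coboundary_def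
    by (intro conjI bexI[of _ "(T ^^ k) x"] Lp_diff p T_Lp funpow_Lp x) auto
  from coboundary_add[OF Suc this] show ?case by simp
qed (simp add: coboundary_zero)

text \<open>The difference is the mean of the functions \<open>x - (T ^^ k) x\<close>, each of which
  telescopes into coboundaries.\<close>

lemma coboundary_ergodic_average:
  assumes x: "x \<in> Lp M p"
  shows "coboundary (\<lambda>\<omega>. x \<omega> - ergodic_average T n x \<omega>)"
proof -
  have "x \<omega> - ergodic_average T n x \<omega>
      = 1 / of_nat (n + 1) * (\<Sum>k=0..n. x \<omega> - (T ^^ k) x \<omega>)" for \<omega>
    by (simp add: ergodic_average_def sum_subtractf right_diff_distrib del: of_nat_Suc)
  then show ?thesis
    by (simp only:) (intro coboundary_cmult coboundary_sum coboundary_orbit x)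
qed

text \<open>Telescoping leaves two terms of norm at most that of \<open>u\<close>, divided by
  \<open>n + 1\<close>.\<close>

lemma ergodic_average_coboundary_norm:
  assumes z: "coboundary z"
  shows "(\<lambda>n. Lp_norm M p (ergodic_average T n z)) \<longlonglongrightarrow> 0"
proof -
  from z obtain u where u: "u \<in> Lp M p" and zu: "AE \<omega> in M. z \<omega> = u \<omega> - T u \<omega>" and zL: "z \<in> Lp M p"
    by (auto simp: coboundary_def)
  have uT: "(\<lambda>\<omega>. u \<omega> - T u \<omega>) \<in> Lp M p"
    by (intro Lp_diff p u T_Lp)
  have bound: "Lp_norm M p (ergodic_average T n z) \<le> 2 * Lp_norm M p u / real (n + 1)" for n
  proof -
    have d: "(\<lambda>\<omega>. u \<omega> - (T ^^ Suc n) u \<omega>) \<in> Lp M p"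
      by (intro Lp_diff p u funpow_Lp)
    have "AE \<omega> in M. ergodic_average T n z \<omega> = 1 / of_nat (n + 1) * (u \<omega> - (T ^^ Suc n) u \<omega>)"
      using ergodic_average_cong[OF zL uT zu] ergodic_average_coboundary[OF u]
      by eventually_elim simp
    then have "Lp_norm M p (ergodic_average T n z)
        = Lp_norm M p (\<lambda>\<omega>. 1 / of_nat (n + 1) * (u \<omega> - (T ^^ Suc n) u \<omega>))"
      by (intro Lp_norm_cong_AE p_pos ergodic_average_Lp zL Lp_cmult d)
    also have "\<dots> = 1 / real (n + 1) * Lp_norm M p (\<lambda>\<omega>. u \<omega> - (T ^^ Suc n) u \<omega>)"
      unfolding Lp_norm_mult[OF p_pos] by (simp add: norm_divide del: of_nat_Suc of_nat_add)
    also have "\<dots> \<le> 1 / real (n + 1) * (2 * Lp_norm M p u)"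
    proof (rule mult_left_mono)
      have "Lp_norm M p (\<lambda>\<omega>. u \<omega> - (T ^^ Suc n) u \<omega>) \<le> Lp_norm M p u + Lp_norm M p ((T ^^ Suc n) u)"
        by (intro Lp_norm_triangle p LpD(2) u funpow_Lp AE_I2 norm_triangle_ineq4)
      also have "\<dots> \<le> Lp_norm M p u + Lp_norm M p u"
        by (intro add_left_mono funpow_contraction u)
      finally show "Lp_norm M p (\<lambda>\<omega>. u \<omega> - (T ^^ Suc n) u \<omega>) \<le> 2 * Lp_norm M p u" by simp
    qed simp
    finally show ?thesis by simp
  qed
  have lim: "(\<lambda>n. 2 * Lp_norm M p u / real (n + 1)) \<longlonglongrightarrow> 0"
    using LIMSEQ_ignore_initial_segment[OF lim_const_over_n[of "2 * Lp_norm M p u"], of 1] by simp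
  show ?thesis
  proof (rule Lim_null_comparison[OF always_eventually lim], rule allI)
    show "norm (Lp_norm M p (ergodic_average T n z)) \<le> 2 * Lp_norm M p u / real (n + 1)" for n
      using bound[of n] by (simp only: real_norm_def abs_of_nonneg[OF Lp_norm_nonneg])
  qed
qed

subsection \<open>The mean ergodic theorem\<close>

(* All averages lie in the affine space x + R(I - T); their norms converge to the infimum m of the
   norm there, and midpoints stay in that space, so uniform convexity makes them a Cauchy sequence. *)
lemma ergodic_average_Cauchy:
  assumes x: "x \<in> Lp M p" and e: "0 < e"
  shows "\<exists>N. \<forall>j\<ge>N. \<forall>k\<ge>N.
    Lp_norm M p (\<lambda>\<omega>. ergodic_average T j x \<omega> - ergodic_average T k x \<omega>) < e"
proof -
  let ?a = "\<lambda>n. ergodic_average T n x"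
  note a = ergodic_average_Lp[OF x]
  define C where "C = {y \<in> Lp M p. coboundary (\<lambda>\<omega>. x \<omega> - y \<omega>)}"
  define m where "m = Inf (Lp_norm M p ` C)"
  have aC: "?a n \<in> C" for n
    by (simp add: C_def a coboundary_ergodic_average x)
  have bdd: "bdd_below (Lp_norm M p ` C)"
    by (rule bdd_belowI[of _ 0]) (auto simp: Lp_norm_nonneg)
  have m_le: "m \<le> Lp_norm M p y" if "y \<in> C" for y
    unfolding m_def using bdd that by (intro cInf_lower) auto
  have m: "0 \<le> m"
    unfolding m_def using aC by (intro cInf_greatest) (auto simp: Lp_norm_nonneg)
  have midpoint: "(\<lambda>\<omega>. (?a j \<omega> + ?a k \<omega>) / 2) \<in> C" for j k
  proof -
    have "coboundary (\<lambda>\<omega>. 1/2 * ((x \<omega> - ?a j \<omega>) + (x \<omega> - ?a k \<omega>)))"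
      by (intro coboundary_cmult coboundary_add coboundary_ergodic_average x)
    moreover have "(\<lambda>\<omega>. 1/2 * ((x \<omega> - ?a j \<omega>) + (x \<omega> - ?a k \<omega>)))
        = (\<lambda>\<omega>. x \<omega> - (?a j \<omega> + ?a k \<omega>) / 2)"
      by (simp add: fun_eq_iff field_simps)
    moreover have "(\<lambda>\<omega>. (?a j \<omega> + ?a k \<omega>) / 2) \<in> Lp M p"
      using Lp_cmult[OF Lp_add[OF p a[of j] a[of k]], of "1/2"] by simp
    ultimately show ?thesis by (simp only: C_def mem_Collect_eq)
  qed
  have "(\<lambda>n. Lp_norm M p (?a n)) \<longlonglongrightarrow> m"
  proof (rule LIMSEQ_I)
    fix r :: real assume r: "0 < r"
    then have "Inf (Lp_norm M p ` C) < m + r / 2" by (simp add: m_def)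
    \<comment> \<open>For a nearly minimal \<open>y\<close> the averages of \<open>x\<close> and
      \<open>y\<close> differ by those of the coboundary \<open>x - y\<close>, which vanish in norm,
      and averaging does not increase the norm of \<open>y\<close>.\<close>
    then obtain y where y: "y \<in> C" "Lp_norm M p y < m + r / 2"
      using aC by (subst (asm) cInf_less_iff[OF _ bdd]) auto
    then have yL: "y \<in> Lp M p" and cob: "coboundary (\<lambda>\<omega>. x \<omega> - y \<omega>)"
      by (auto simp: C_def)
    have dL: "(\<lambda>\<omega>. x \<omega> - y \<omega>) \<in> Lp M p" by (intro Lp_diff p x yL)
    obtain N where N: "\<And>n. n \<ge> N \<Longrightarrow> Lp_norm M p (ergodic_average T n (\<lambda>\<omega>. x \<omega> - y \<omega>)) < r / 2"
      using LIMSEQ_D[OF ergodic_average_coboundary_norm[OF cob], of "r / 2"] r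
      by (auto simp: Lp_norm_nonneg)
    have "norm (Lp_norm M p (?a n) - m) < r" if n: "n \<ge> N" for n
    proof -
      have "Lp_norm M p (?a n)
          \<le> Lp_norm M p (ergodic_average T n y) + Lp_norm M p (ergodic_average T n (\<lambda>\<omega>. x \<omega> - y \<omega>))"
      proof (intro Lp_norm_triangle p LpD(2) ergodic_average_Lp yL dL)
        show "AE \<omega> in M. norm (?a n \<omega>)
            \<le> norm (ergodic_average T n y \<omega>) + norm (ergodic_average T n (\<lambda>\<omega>. x \<omega> - y \<omega>) \<omega>)"
          using ergodic_average_diff[OF x yL]
        proof eventually_elim
          case (elim \<omega>)
          then show ?case
            using norm_triangle_ineq[of "ergodic_average T n y \<omega>" "?a n \<omega> - ergodic_average T n y \<omega>"]
            by simp
        qed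
      qed
      also have "\<dots> < m + r"
        using N[OF n] ergodic_average_contraction[OF yL, of n] y(2) by simp
      finally show ?thesis using m_le[OF aC[of n]] by simp
    qed
    then show "\<exists>N. \<forall>n\<ge>N. norm (Lp_norm M p (?a n) - m) < r" by blast
  qed
  then have lim: "(\<lambda>n. Lp_norm M p (?a n) powr p) \<longlonglongrightarrow> m powr p"
    using p by (intro tendsto_powr') (auto simp: Lp_norm_nonneg)
  \<comment> \<open>Since \<open>r\<close> below is at most 1, both powers of norms stay below
    \<open>m powr p + 1\<close>, and the term with \<open>\<eta>\<close> is at most half of
    \<open>e powr p\<close>. The choice of \<open>r\<close> keeps the term with \<open>K\<close>
    below a quarter, which leaves room for a strict inequality.\<close>
  define \<eta> where "\<eta> = e powr p / (4 * (m powr p + 1))"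
  have \<eta>: "0 < \<eta>" using e by (simp add: \<eta>_def add_nonneg_pos)
  obtain K where K: "K \<ge> 0" "\<And>f g. f \<in> Lp M p \<Longrightarrow> g \<in> Lp M p \<Longrightarrow>
      Lp_norm M p (\<lambda>\<omega>. f \<omega> - g \<omega>) powr p
      \<le> \<eta> * (Lp_norm M p f powr p + Lp_norm M p g powr p)
        + K * ((Lp_norm M p f powr p + Lp_norm M p g powr p) / 2
               - Lp_norm M p (\<lambda>\<omega>. (f \<omega> + g \<omega>) / 2) powr p)"
    using Lp_uniform_convexity[OF p \<eta>] by blast
  define r where "r = min 1 (e powr p / (4 * (K + 1)))"
  have r: "0 < r" using e K(1) by (simp add: r_def)
  have Kr: "K * r \<le> e powr p / 4"
  proof -
    have "K * r \<le> K * (e powr p / (4 * (K + 1)))"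
      using K(1) by (intro mult_left_mono) (auto simp: r_def)
    also have "\<dots> \<le> e powr p / 4"
      using K(1) by (simp add: field_simps)
    finally show ?thesis .
  qed
  obtain N where N: "\<And>n. n \<ge> N \<Longrightarrow> Lp_norm M p (?a n) powr p \<le> m powr p + r"
    using LIMSEQ_D[OF lim r] by (force simp: abs_le_iff abs_less_iff)
  have "Lp_norm M p (\<lambda>\<omega>. ?a j \<omega> - ?a k \<omega>) < e" if "j \<ge> N" "k \<ge> N" for j k
  proof -
    have mid: "m powr p \<le> Lp_norm M p (\<lambda>\<omega>. (?a j \<omega> + ?a k \<omega>) / 2) powr p"
      using m p m_le[OF midpoint] by (intro powr_mono2) auto
    note Nj = N[OF that(1)] and Nk = N[OF that(2)]
    have "Lp_norm M p (\<lambda>\<omega>. ?a j \<omega> - ?a k \<omega>) powr p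
      \<le> \<eta> * (Lp_norm M p (?a j) powr p + Lp_norm M p (?a k) powr p)
        + K * ((Lp_norm M p (?a j) powr p + Lp_norm M p (?a k) powr p) / 2
               - Lp_norm M p (\<lambda>\<omega>. (?a j \<omega> + ?a k \<omega>) / 2) powr p)"
      by (rule K(2)[OF a a])
    also have "\<dots> \<le> \<eta> * (2 * (m powr p + 1)) + K * r"
    proof (intro add_mono mult_left_mono)
      have "A + B \<le> 2 * (D + 1)" if "A \<le> D + r" "B \<le> D + r" for A B D
        using that by (simp add: r_def)
      from this[OF Nj Nk]
      show "Lp_norm M p (?a j) powr p + Lp_norm M p (?a k) powr p \<le> 2 * (m powr p + 1)" .
      have "(A + B) / 2 - D \<le> r" if "A \<le> m powr p + r" "B \<le> m powr p + r" "m powr p \<le> D" for A B D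
        using that by (simp add: field_simps)
      from this[OF Nj Nk mid]
      show "(Lp_norm M p (?a j) powr p + Lp_norm M p (?a k) powr p) / 2
          - Lp_norm M p (\<lambda>\<omega>. (?a j \<omega> + ?a k \<omega>) / 2) powr p \<le> r" .
    qed (use K(1) \<eta> in auto)
    also have "\<eta> * (2 * (m powr p + 1)) = e powr p / 2"
    proof -
      have "m powr p + 1 > 0" by (simp add: add_nonneg_pos)
      then show ?thesis by (simp add: \<eta>_def field_simps)
    qed
    also have "e powr p / 2 + K * r < e powr p"
    proof -
      have "A / 2 + B < A" if "B \<le> A / 4" "0 < A" for A B :: real
        using that by simp
      from this[OF Kr] show ?thesis using e by simp
    qed
    finally show ?thesis
      using p powr_mono2[of p e "Lp_norm M p (\<lambda>\<omega>. ?a j \<omega> - ?a k \<omega>)"] e by force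
  qed
  then show ?thesis by blast
qed

text \<open>\<open>y\<close> is the norm limit of the averages. Applying \<open>I - T\<close> to an
  average of \<open>x\<close> gives the average of the coboundary \<open>x - T x\<close>, which
  tends to 0, so \<open>y\<close> is fixed; and \<open>x - y\<close> is the limit of the
  coboundaries \<open>x - ?a n\<close>.\<close>

lemma mean_ergodic_decomposition:
  assumes x: "x \<in> Lp M p"
  shows "\<exists>y\<in>ker_I_minus M p T. (\<lambda>\<omega>. x \<omega> - y \<omega>) \<in> closure_range_I_minus M p T"
proof -
  let ?a = "\<lambda>n. ergodic_average T n x"
  note a = ergodic_average_Lp[OF x]
  obtain y where y: "y \<in> Lp M p" and lim: "(\<lambda>n. Lp_norm M p (\<lambda>\<omega>. ?a n \<omega> - y \<omega>)) \<longlonglongrightarrow> 0"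
    using Lp_complete[OF p a ergodic_average_Cauchy[OF x]] by blast
  have uT: "(\<lambda>\<omega>. x \<omega> - T x \<omega>) \<in> Lp M p"
    by (intro Lp_diff p x T_Lp)
  have cob: "coboundary (\<lambda>\<omega>. x \<omega> - T x \<omega>)"
    using coboundary_orbit[OF x, of 1] by simp
  have T_avg: "AE \<omega> in M. ?a n \<omega> - T (?a n) \<omega> = ergodic_average T n (\<lambda>\<omega>. x \<omega> - T x \<omega>) \<omega>" for n
  proof -
    have "AE \<omega> in M. T (?a n) \<omega> = 1 / of_nat (n + 1) * T (\<lambda>\<omega>. \<Sum>k=0..n. (T ^^ k) x \<omega>) \<omega>"
      unfolding ergodic_average_def by (intro T_cmult Lp_sum p funpow_Lp x)
    moreover have "AE \<omega> in M. T (\<lambda>\<omega>. \<Sum>k=0..n. (T ^^ k) x \<omega>) \<omega> = (\<Sum>k=0..n. T ((T ^^ k) x) \<omega>)"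
      by (intro T_sum funpow_Lp x)
    moreover have "AE \<omega> in M. \<forall>n. ergodic_average T n (\<lambda>\<omega>. x \<omega> - T x \<omega>) \<omega>
        = ?a n \<omega> - ergodic_average T n (T x) \<omega>"
      by (intro ergodic_average_diff x T_Lp)
    ultimately show ?thesis
      by eventually_elim (simp add: ergodic_average_def funpow_swap1)
  qed
  have Ty: "T y \<in> Lp M p" and Ta: "T (?a n) \<in> Lp M p" for n
    by (intro T_Lp y a)+
  have "Lp_norm M p (\<lambda>\<omega>. y \<omega> - T y \<omega>)
      \<le> 2 * Lp_norm M p (\<lambda>\<omega>. ?a n \<omega> - y \<omega>) + Lp_norm M p (ergodic_average T n (\<lambda>\<omega>. x \<omega> - T x \<omega>))" for n
  proof -
    have "Lp_norm M p (\<lambda>\<omega>. y \<omega> - T y \<omega>)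
        \<le> Lp_norm M p (\<lambda>\<omega>. y \<omega> - ?a n \<omega>) + Lp_norm M p (\<lambda>\<omega>. ?a n \<omega> - T y \<omega>)"
      by (intro Lp_norm_triangle_diff p y a Ty)
    also have "Lp_norm M p (\<lambda>\<omega>. ?a n \<omega> - T y \<omega>)
        \<le> Lp_norm M p (\<lambda>\<omega>. ?a n \<omega> - T (?a n) \<omega>) + Lp_norm M p (\<lambda>\<omega>. T (?a n) \<omega> - T y \<omega>)"
      by (intro Lp_norm_triangle_diff p a Ta Ty)
    also have "Lp_norm M p (\<lambda>\<omega>. T (?a n) \<omega> - T y \<omega>) \<le> Lp_norm M p (\<lambda>\<omega>. ?a n \<omega> - y \<omega>)"
      by (intro contraction_diff a y)
    also have "Lp_norm M p (\<lambda>\<omega>. ?a n \<omega> - T (?a n) \<omega>)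
        = Lp_norm M p (ergodic_average T n (\<lambda>\<omega>. x \<omega> - T x \<omega>))"
      by (intro Lp_norm_cong_AE p_pos Lp_diff p a Ta ergodic_average_Lp uT T_avg)
    also have "Lp_norm M p (\<lambda>\<omega>. y \<omega> - ?a n \<omega>) = Lp_norm M p (\<lambda>\<omega>. ?a n \<omega> - y \<omega>)"
      by (simp add: Lp_norm_def norm_minus_commute)
    finally show ?thesis by simp
  qed
  moreover have "(\<lambda>n. 2 * Lp_norm M p (\<lambda>\<omega>. ?a n \<omega> - y \<omega>)
      + Lp_norm M p (ergodic_average T n (\<lambda>\<omega>. x \<omega> - T x \<omega>))) \<longlonglongrightarrow> 2 * 0 + 0"
    by (intro tendsto_intros lim ergodic_average_coboundary_norm cob)
  ultimately have "Lp_norm M p (\<lambda>\<omega>. y \<omega> - T y \<omega>) \<le> 0"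
    by (intro LIMSEQ_le_const[where X = "\<lambda>n. 2 * Lp_norm M p (\<lambda>\<omega>. ?a n \<omega> - y \<omega>)
      + Lp_norm M p (ergodic_average T n (\<lambda>\<omega>. x \<omega> - T x \<omega>))"]) auto
  then have "AE \<omega> in M. y \<omega> - T y \<omega> = 0"
    by (intro Lp_norm_eq_0_imp_AE[where p = p] Lp_diff p y Ty antisym Lp_norm_nonneg)
  then have "y \<in> ker_I_minus M p T"
    using y by (simp add: ker_I_minus_def)
  moreover have "(\<lambda>\<omega>. x \<omega> - y \<omega>) \<in> closure_range_I_minus M p T"
    unfolding closure_range_I_minus_def
  proof (intro CollectI conjI allI impI Lp_diff p x y)
    fix e :: real assume "0 < e"
    then obtain n where n: "Lp_norm M p (\<lambda>\<omega>. ?a n \<omega> - y \<omega>) < e"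
      using LIMSEQ_D[OF lim, of e] by (auto simp: Lp_norm_nonneg)
    obtain u where u: "u \<in> Lp M p" "AE \<omega> in M. x \<omega> - ?a n \<omega> = u \<omega> - T u \<omega>"
      using coboundary_ergodic_average[OF x, of n] by (auto simp: coboundary_def)
    have "Lp_norm M p (\<lambda>\<omega>. x \<omega> - y \<omega> - (u \<omega> - T u \<omega>)) = Lp_norm M p (\<lambda>\<omega>. ?a n \<omega> - y \<omega>)"
    proof (intro Lp_norm_cong_AE p_pos Lp_diff p x y a u T_Lp)
      show "AE \<omega> in M. x \<omega> - y \<omega> - (u \<omega> - T u \<omega>) = ?a n \<omega> - y \<omega>"
        using u(2) by eventually_elim (simp add: algebra_simps)
    qed
    with n u(1) show "\<exists>u\<in>Lp M p. Lp_norm M p (\<lambda>\<omega>. x \<omega> - y \<omega> - (u \<omega> - T u \<omega>)) < e"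
      by (intro bexI[of _ u]) auto
  qed
  ultimately show ?thesis by blast
qed

subsection \<open>Pointwise convergence\<close>

text \<open>The only critical term is the iterate \<open>(T ^^ Suc n) u\<close> divided by
  \<open>n + 1\<close>. Its p-th moment is at most a constant times
  \<open>real (n + 1) powr - p\<close>, which is summable because \<open>p > 1\<close>.\<close>

lemma ergodic_average_coboundary_pointwise:
  assumes u: "u \<in> Lp M p"
  shows "AE \<omega> in M. (\<lambda>n. ergodic_average T n (\<lambda>\<omega>. u \<omega> - T u \<omega>) \<omega>) \<longlonglongrightarrow> 0"
proof -
  define d where "d = (\<lambda>n \<omega>. 1 / of_nat (n + 1) * (T ^^ Suc n) u \<omega>)"
  have d: "d n \<in> Lp M p" for n
    unfolding d_def by (intro Lp_cmult funpow_Lp u)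
  have "AE \<omega> in M. (\<lambda>n. d n \<omega>) \<longlonglongrightarrow> 0"
  proof (rule AE_tendsto_zero_if_summable_integral[OF p_pos LpD(2)[OF d]])
    show "summable (\<lambda>n. \<integral>\<omega>. norm (d n \<omega>) powr p \<partial>M)"
    proof (rule summable_comparison_test')
      have "summable (\<lambda>n. real (n + 1) powr - p)"
        using p summable_ignore_initial_segment[of "\<lambda>n. real n powr - p" 1]
        by (simp add: summable_real_powr_iff)
      then show "summable (\<lambda>n. Lp_norm M p u powr p * real (n + 1) powr - p)"
        by (rule summable_mult)
      fix n
      have "Lp_norm M p (d n) = Lp_norm M p ((T ^^ Suc n) u) / real (n + 1)"
        unfolding d_def Lp_norm_mult[OF p_pos] by (simp add: norm_divide del: of_nat_Suc of_nat_add)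
      also have "\<dots> \<le> Lp_norm M p u / real (n + 1)"
        by (intro divide_right_mono funpow_contraction u) simp
      finally have "(\<integral>\<omega>. norm (d n \<omega>) powr p \<partial>M) \<le> (Lp_norm M p u / real (n + 1)) powr p"
        using p by (subst (asm) Lp_norm_le_iff) (auto simp: Lp_norm_nonneg)
      then show "norm (\<integral>\<omega>. norm (d n \<omega>) powr p \<partial>M) \<le> Lp_norm M p u powr p * real (n + 1) powr - p"
        by (simp add: powr_divide Lp_norm_nonneg powr_minus field_simps)
    qed
  qed
  with ergodic_average_coboundary[OF u] show ?thesis
  proof eventually_elim
    case (elim \<omega>)
    have "(\<lambda>n. u \<omega> * of_real (1 / real (Suc n))) \<longlonglongrightarrow> u \<omega> * of_real 0"
      by (intro tendsto_intros LIMSEQ_Suc[OF lim_1_over_n])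
    with elim(2) have "(\<lambda>n. u \<omega> * of_real (1 / real (Suc n)) - d n \<omega>) \<longlonglongrightarrow> u \<omega> * of_real 0 - 0"
      by (intro tendsto_diff)
    moreover have "u \<omega> * of_real (1 / real (Suc n)) - d n \<omega>
        = ergodic_average T n (\<lambda>\<omega>. u \<omega> - T u \<omega>) \<omega>" for n
      using elim(1) by (simp add: d_def diff_divide_distrib del: funpow.simps)
    ultimately show ?case by simp
  qed
qed

text \<open>Banach's principle: \<open>z\<close> is a coboundary up to a remainder of small norm,
  whose averages are bounded, uniformly in \<open>n\<close>, by a maximal function of comparably
  small norm. Remainders of norm below \<open>(1/2) ^ j\<close> make the maximal functions
  \<open>F j\<close> tend to 0 almost everywhere.\<close>

lemma ergodic_average_closure_range_pointwise:
  assumes z: "z \<in> closure_range_I_minus M p T"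
  shows "AE \<omega> in M. (\<lambda>n. ergodic_average T n z \<omega>) \<longlonglongrightarrow> 0"
proof -
  have zL: "z \<in> Lp M p" using z by (simp add: closure_range_I_minus_def)
  have "\<forall>j. \<exists>u\<in>Lp M p. Lp_norm M p (\<lambda>\<omega>. z \<omega> - (u \<omega> - T u \<omega>)) < (1/2) ^ j"
    using z by (simp add: closure_range_I_minus_def)
  then obtain u where u: "\<And>j. u j \<in> Lp M p"
    "\<And>j. Lp_norm M p (\<lambda>\<omega>. z \<omega> - (u j \<omega> - T (u j) \<omega>)) < (1/2) ^ j"
    by metis
  let ?c = "\<lambda>j \<omega>. u j \<omega> - T (u j) \<omega>"
  let ?r = "\<lambda>j \<omega>. z \<omega> - ?c j \<omega>"
  have c: "?c j \<in> Lp M p" for j by (intro Lp_diff p u T_Lp)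
  have r: "?r j \<in> Lp M p" for j by (intro Lp_diff p zL c)
  let ?q = "p / (p - 1)"
  have "\<forall>j. \<exists>F. integrable M (\<lambda>\<omega>. norm (F \<omega> :: real) powr p)
      \<and> Lp_norm M p F \<le> ?q * Lp_norm M p (?r j)
      \<and> (AE \<omega> in M. \<forall>n. norm (ergodic_average T n (?r j) \<omega>) \<le> F \<omega>)"
    by (intro allI maximal_function r)
  from choice[OF this] obtain F where F: "\<And>j. integrable M (\<lambda>\<omega>. norm (F j \<omega> :: real) powr p)"
    "\<And>j. Lp_norm M p (F j) \<le> ?q * Lp_norm M p (?r j)"
    "\<And>j. AE \<omega> in M. \<forall>n. norm (ergodic_average T n (?r j) \<omega>) \<le> F j \<omega>"
    by blast
  have "AE \<omega> in M. (\<lambda>j. F j \<omega>) \<longlonglongrightarrow> 0"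
  proof (rule AE_tendsto_zero_if_summable_integral[OF p_pos F(1)])
    show "summable (\<lambda>j. \<integral>\<omega>. norm (F j \<omega>) powr p \<partial>M)"
    proof (rule summable_comparison_test')
      show "summable (\<lambda>j. ?q powr p * (1/2) ^ j)"
        by (intro summable_mult summable_geometric) simp
      fix j
      have "Lp_norm M p (F j) \<le> ?q * (1/2) ^ j"
        using p u(2)[of j] by (intro order_trans[OF F(2)] mult_left_mono) auto
      then have "(\<integral>\<omega>. norm (F j \<omega>) powr p \<partial>M) \<le> (?q * (1/2) ^ j) powr p"
        using p by (subst (asm) Lp_norm_le_iff) auto
      also have "\<dots> = ?q powr p * ((1/2) ^ j) powr p"
        using p by (subst powr_mult) auto
      also have "\<dots> \<le> ?q powr p * (1/2) ^ j"
        using p powr_mono'[of 1 p "(1/2) ^ j :: real"] by (intro mult_left_mono) (auto simp: power_le_one)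
      finally show "norm (\<integral>\<omega>. norm (F j \<omega>) powr p \<partial>M) \<le> ?q powr p * (1/2) ^ j" by simp
    qed
  qed
  moreover have "AE \<omega> in M. \<forall>j n. norm (ergodic_average T n (?r j) \<omega>) \<le> F j \<omega>"
    by (rule AE_all_countable[THEN iffD2], rule allI, rule F(3))
  moreover have "AE \<omega> in M. \<forall>j n. ergodic_average T n (?r j) \<omega>
      = ergodic_average T n z \<omega> - ergodic_average T n (?c j) \<omega>"
    by (rule AE_all_countable[THEN iffD2], rule allI, rule ergodic_average_diff[OF zL c])
  moreover have "AE \<omega> in M. \<forall>j. (\<lambda>n. ergodic_average T n (?c j) \<omega>) \<longlonglongrightarrow> 0"
    by (rule AE_all_countable[THEN iffD2], rule allI, rule ergodic_average_coboundary_pointwise[OF u(1)])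
  ultimately show ?thesis
  proof eventually_elim
    case (elim \<omega>)
    show ?case
    proof (rule LIMSEQ_I)
      fix e :: real assume e: "0 < e"
      \<comment> \<open>At the given point \<open>j\<close> is fixed by the maximal function alone;
        only then is \<open>n\<close> taken large, for the coboundary with this
        \<open>j\<close>.\<close>
      then obtain j where "norm (F j \<omega> - 0) < e / 2"
        using LIMSEQ_D[OF elim(1), of "e / 2"] half_gt_zero by blast
      then have j: "F j \<omega> < e / 2" by simp
      obtain N where N: "\<And>n. n \<ge> N \<Longrightarrow> norm (ergodic_average T n (?c j) \<omega>) < e / 2"
        using LIMSEQ_D[OF elim(4)[rule_format, of j], of "e / 2"] e by auto
      have "norm (ergodic_average T n z \<omega> - 0) < e" if "n \<ge> N" for n
      proof -
        have "ergodic_average T n z \<omega> = ergodic_average T n (?r j) \<omega> + ergodic_average T n (?c j) \<omega>"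
          using elim(3) by simp
        then have "norm (ergodic_average T n z \<omega>)
            \<le> norm (ergodic_average T n (?r j) \<omega>) + norm (ergodic_average T n (?c j) \<omega>)"
          by (metis norm_triangle_ineq)
        then show ?thesis
          using elim(2)[rule_format, of n j] j N[OF that] by simp
      qed
      then show "\<exists>N. \<forall>n\<ge>N. norm (ergodic_average T n z \<omega> - 0) < e" by blast
    qed
  qed
qed

text \<open>Only the two defining properties of the projection enter, so the argument applies to
  whichever representative the choice operator returns: averages leave \<open>y\<close> unchanged,
  and those of \<open>x - y\<close> tend to 0.\<close>

lemma pointwise_ergodic:
  assumes x: "x \<in> Lp M p"
  shows "AE \<omega> in M. (\<lambda>n. ergodic_average T n x \<omega>) \<longlonglongrightarrow> mean_ergodic_projection M p T x \<omega>"
proof -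
  define y where "y = mean_ergodic_projection M p T x"
  have "\<exists>y. y \<in> ker_I_minus M p T \<and> (\<lambda>\<omega>. x \<omega> - y \<omega>) \<in> closure_range_I_minus M p T"
    using mean_ergodic_decomposition[OF x] by auto
  from someI_ex[OF this]
  have "y \<in> ker_I_minus M p T \<and> (\<lambda>\<omega>. x \<omega> - y \<omega>) \<in> closure_range_I_minus M p T"
    unfolding y_def mean_ergodic_projection_def .
  then have y: "y \<in> Lp M p" "AE \<omega> in M. y \<omega> = T y \<omega>"
    and z: "(\<lambda>\<omega>. x \<omega> - y \<omega>) \<in> closure_range_I_minus M p T"
    by (auto simp: ker_I_minus_def)
  show ?thesis
    unfolding y_def[symmetric]
    using ergodic_average_closure_range_pointwise[OF z] ergodic_average_fixed[OF y]
      ergodic_average_diff[OF x y(1)]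
  proof eventually_elim
    case (elim \<omega>)
    then have "(\<lambda>n. ergodic_average T n x \<omega> - y \<omega>) \<longlonglongrightarrow> 0" by simp
    then show ?case by (simp add: LIM_zero_iff)
  qed
qed

end

text \<open>That the infimum of the bounds is itself a bound is obtained by a limit: every
  \<open>C > 1\<close> exceeds an admissible bound \<open>D\<close>, and \<open>C\<close> tends to 1
  from the right.\<close>

lemma contractively_regular_imp_operator:
  assumes p: "1 < p" and T: "contractively_regular M p T"
  shows "contractively_regular_operator M p T"
proof
  have lin: "Lp_bounded_linear M p T" and bound: "\<exists>C. regular_bound M p T C"
    and norm: "regular_norm M p T \<le> 1"
    using T by (auto simp: contractively_regular_def regular_def)
  show "T f \<in> Lp M p" if "f \<in> Lp M p" for f
    using lin that by (simp add: Lp_bounded_linear_def)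
  show "AE \<omega> in M. T f \<omega> = T g \<omega>" if "f \<in> Lp M p" "g \<in> Lp M p" "AE \<omega> in M. f \<omega> = g \<omega>" for f g
    using lin that by (simp add: Lp_bounded_linear_def)
  show "AE \<omega> in M. T (\<lambda>\<omega>. f \<omega> + g \<omega>) \<omega> = T f \<omega> + T g \<omega>" if "f \<in> Lp M p" "g \<in> Lp M p" for f g
    using lin that by (simp add: Lp_bounded_linear_def)
  show "AE \<omega> in M. T (\<lambda>\<omega>. c * f \<omega>) \<omega> = c * T f \<omega>" if "f \<in> Lp M p" for c f
    using lin that by (simp add: Lp_bounded_linear_def)
  show "Lp_norm M p (\<lambda>\<omega>. MAX k\<in>{..n}. norm (T (x k) \<omega>)) \<le> Lp_norm M p (\<lambda>\<omega>. MAX k\<in>{..n}. norm (x k \<omega>))"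
    (is "?l \<le> ?r") if x: "\<And>k. k \<le> n \<Longrightarrow> x k \<in> Lp M p" for n :: nat and x
  proof (rule tendsto_lowerbound)
    show "((\<lambda>C. C * ?r) \<longlongrightarrow> ?r) (at_right 1)"
      by (rule tendsto_eq_intros refl | simp)+
    have "?l \<le> C * ?r" if "1 < C" for C
    proof -
      have "Inf {C. regular_bound M p T C} < C"
        using norm that by (simp add: regular_norm_def)
      then obtain D where D: "regular_bound M p T D" "D < C"
        using bound by (auto dest!: cInf_lessD[rotated])
      then have "?l \<le> D * ?r"
        using x by (intro D(1)[unfolded regular_bound_def, THEN conjunct2, rule_format]) auto
      also have "\<dots> \<le> C * ?r"
        using D(2) by (intro mult_right_mono Lp_norm_nonneg) simp
      finally show ?thesis .
    qed
    then show "\<forall>\<^sub>F C in at_right 1. ?l \<le> C * ?r"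
      by (auto simp: eventually_at_right_less eventually_at_filter)
  qed simp
qed (rule p)

theorem corollary5p1:
  fixes M :: "'a measure" and p :: real
    and T :: "('a \<Rightarrow> complex) \<Rightarrow> ('a \<Rightarrow> complex)" and x :: "'a \<Rightarrow> complex"
  assumes "1 < p"
    and "contractively_regular M p T"
    and "x \<in> Lp M p"
  shows "AE \<omega> in M. (\<lambda>n. ergodic_average T n x \<omega>)
           \<longlonglongrightarrow> mean_ergodic_projection M p T x \<omega>"
  by (rule contractively_regular_operator.pointwise_ergodic
      [OF contractively_regular_imp_operator[OF assms(1,2)] assms(3)])

end
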